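(* Let $\ell\geq 1$ be a fixed integer and let $\alpha>1/4$. Then for any disk $D\subset\mathbb{R}^2$ of radius $N^{\alpha}$ and every fully correlated state $\Psi_F$ of $N$ particles, $$\int_{D}\rho_F \;\leq\; \frac{1}{\pi\ell}\,|D|\,(1+o(1)),$$ where $|D|=\pi N^{2\alpha}$ is the area of the disk and $o(1)$ tends to zero as $N\to\infty$, uniformly in the choice of $F$. That is, for every $\eta>0$ there is an $N_0$ (depending only on $\ell,\alpha,\eta$) such that for all $N\geq N_0$, all disks $D$ of radius $N^\alpha$, and all fully correlated states $\Psi_F$ of $N$ particles one has $\int_D\rho_F\leq \frac{1}{\pi\ell}|D|(1+\eta)$.
   Context: Identify $\mathbb{R}^2$ with $\mathbb{C}$. For integers $\ell\geq 1$ and $N\geq 1$ the Laughlin state is $$\Psi_{\rm Lau}(z_1,\dots,z_N)=c_{\rm Lau}\prod_{1\leq i<j\leq N}(z_i-z_j)^{\ell}\,e^{-\sum_{i=1}^N|z_i|^2/2},\qquad z_i\in\mathbb{C},$$ where $c_{\rm Lau}$ (depending on $N,\ell$) normalizes $\Psi_{\rm Lau}$ in $L^2(\mathbb{R}^{2N})$. A fully correlated state is a function of the form $$\Psi_F(z_1,\dots,z_N)=F(z_1,\dots,z_N)\,\Psi_{\rm Lau}(z_1,\dots,z_N),$$ where $F:\mathbb{C}^N\to\mathbb{C}$ is analytic (entire, not necessarily a polynomial) and symmetric under exchange of the $z_i$, and $\Psi_F$ is normalized: $\int_{\mathbb{R}^{2N}}|\Psi_F|^2=1$. Its one-particle density is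 $$\rho_F(z)=N\int_{\mathbb{R}^{2(N-1)}}|\Psi_F(z,z_2,\dots,z_N)|^2\,dz_2\cdots dz_N,$$ with $dz$ denoting Lebesgue measure on $\mathbb{R}^2$, so that $\int_{\mathbb{R}^2}\rho_F=N$. *)

theory Defs
  imports "HOL-Analysis.Analysis"
begin

text \<open>
  Points of \<open>\<complex>\<^sup>N\<close> are extensional functions on \<open>{..<N}\<close>, so that the particles
  \<open>1, \<dots>, N\<close> carry the indices \<open>0, \<dots>, N - 1\<close> and \<open>CN N\<close> is the underlying space
  of the product measure \<open>lborel_CN N\<close>. As \<^typ>\<open>complex\<close> is a two-dimensional
  Euclidean space, \<^const>\<open>lborel\<close> on it is Lebesgue measure on the plane.
\<close>

abbreviation CN :: "nat \<Rightarrow> (nat \<Rightarrow> complex) set" where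
  "CN N \<equiv> {..<N} \<rightarrow>\<^sub>E UNIV"

abbreviation lborel_CN :: "nat \<Rightarrow> (nat \<Rightarrow> complex) measure" where
  "lborel_CN N \<equiv> PiM {..<N} (\<lambda>_. lborel)"

definition laughlin_unnormalized :: "nat \<Rightarrow> nat \<Rightarrow> (nat \<Rightarrow> complex) \<Rightarrow> complex" where
  "laughlin_unnormalized l N z =
     (\<Prod>j<N. \<Prod>i<j. (z i - z j) ^ l) * of_real (exp (- (\<Sum>i<N. (cmod (z i))\<^sup>2) / 2))"

text \<open>The normalization constant, determined up to a phase, is taken to be positive.\<close>

definition c_Lau :: "nat \<Rightarrow> nat \<Rightarrow> real" where
  "c_Lau l N = 1 / sqrt (\<integral>z. (cmod (laughlin_unnormalized l N z))\<^sup>2 \<partial>lborel_CN N)"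

definition laughlin :: "nat \<Rightarrow> nat \<Rightarrow> (nat \<Rightarrow> complex) \<Rightarrow> complex" where
  "laughlin l N z = of_real (c_Lau l N) * laughlin_unnormalized l N z"

text \<open>
  Around every point \<open>w\<close>, \<open>F\<close> is the sum of a power series in \<open>N\<close> variables converging
  on a polydisc; the multi-indices \<open>k\<close> range over the extensional functions
  \<open>{..<N} \<rightarrow> \<nat>\<close>. Unordered summability of a complex family is absolute convergence.
\<close>

definition analytic_CN :: "nat \<Rightarrow> ((nat \<Rightarrow> complex) \<Rightarrow> complex) \<Rightarrow> bool" where
  "analytic_CN N F \<longleftrightarrow>
     (\<forall>w\<in>CN N. \<exists>(a :: (nat \<Rightarrow> nat) \<Rightarrow> complex) r. r > 0 \<and>
        (\<forall>z\<in>CN N. (\<forall>i<N. cmod (z i - w i) < r) \<longrightarrow>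
           ((\<lambda>k. a k * (\<Prod>i<N. (z i - w i) ^ k i)) has_sum F z) ({..<N} \<rightarrow>\<^sub>E UNIV)))"

definition symmetric_CN :: "nat \<Rightarrow> ((nat \<Rightarrow> complex) \<Rightarrow> complex) \<Rightarrow> bool" where
  "symmetric_CN N F \<longleftrightarrow> (\<forall>\<sigma>. \<sigma> permutes {..<N} \<longrightarrow> (\<forall>z\<in>CN N. F (z \<circ> \<sigma>) = F z))"

definition correlated_state ::
    "nat \<Rightarrow> nat \<Rightarrow> ((nat \<Rightarrow> complex) \<Rightarrow> complex) \<Rightarrow> (nat \<Rightarrow> complex) \<Rightarrow> complex" where
  "correlated_state l N F z = F z * laughlin l N z"

definition fully_correlated ::
    "nat \<Rightarrow> nat \<Rightarrow> ((nat \<Rightarrow> complex) \<Rightarrow> complex) \<Rightarrow> bool" where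
  "fully_correlated l N F \<longleftrightarrow>
     analytic_CN N F \<and> symmetric_CN N F \<and>
     (\<integral>\<^sup>+ z. ennreal ((cmod (correlated_state l N F z))\<^sup>2) \<partial>lborel_CN N) = 1"

text \<open>
  The density takes values in \<open>[0, \<infinity>]\<close>, so that a divergent integral counts as
  \<open>\<infinity>\<close> and not, as for the Bochner integral, as \<open>0\<close>.
\<close>

definition one_particle_density ::
    "nat \<Rightarrow> nat \<Rightarrow> ((nat \<Rightarrow> complex) \<Rightarrow> complex) \<Rightarrow> complex \<Rightarrow> ennreal" where
  "one_particle_density l N F x =
     of_nat N * (\<integral>\<^sup>+ z. ennreal ((cmod (correlated_state l N F (z(0 := x))))\<^sup>2)
                   \<partial>PiM {1..<N} (\<lambda>_. lborel))"

end

theory Submission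
  imports Defs "HOL-Library.Real_Mod" "HOL-Probability.Probability" "HOL-Complex_Analysis.Complex_Analysis"
    "HOL-Real_Asymp.Real_Asymp"
begin

text \<open>
  Let \<open>f = F \<cdot> \<Prod>\<^sub>i\<^sub><\<^sub>j (z\<^sub>i - z\<^sub>j)\<^sup>l\<close> and fix a monomial \<open>\<Prod>\<^sub>i z\<^sub>i\<^bsup>m\<^sub>i\<^esup>\<close> of its expansion at the
  origin. As \<open>f\<close> vanishes to order \<open>l s (s - 1) / 2\<close> where any \<open>s\<close> of the variables vanish, any \<open>s\<close> of the
  exponents have sum at least \<open>l s (s - 1) / 2\<close>. By convexity
  \<open>\<Sum>\<^sub>i x\<^bsup>m\<^sub>i\<^esup> \<le> \<Sum>\<^sub>j x\<^bsup>l j\<^esup> \<le> 1 / (1 - x\<^sup>l)\<close> for \<open>0 < x < 1\<close>. Monomials are orthogonal for Gaussian weights,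
  and replacing \<open>exp (-|z\<^sub>i|\<^sup>2)\<close> by \<open>exp (-(1 + t) |z\<^sub>i|\<^sup>2)\<close> multiplies the squared norm of the monomial by
  \<open>x\<^bsup>m\<^sub>i + 1\<^esup>\<close> with \<open>x = 1 / (1 + t)\<close>. Hence \<open>\<integral> \<rho>(z) exp (-t |z|\<^sup>2) dz \<le> x / (1 - x\<^sup>l) \<le> (1 + l t) / (l t)\<close>.
  A magnetic translation changes \<open>F\<close> into another entire function, so the same bound holds for
  Gaussians with any centre \<open>a\<close>. Integrating it over all \<open>a\<close> in a disk of radius \<open>R + r\<close>, with
  \<open>1 \<lless> r \<lless> R\<close> and \<open>1 / r\<^sup>2 \<lless> t \<lless> 1\<close>, bounds the number of particles in the disk of radius \<open>R\<close> by
  \<open>(1 + o(1)) R\<^sup>2 / l\<close> as soon as \<open>R \<rightarrow> \<infinity>\<close>.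
\<close>

section \<open>Rotations, translations and permutations of Lebesgue measure\<close>

text \<open>Lebesgue measure is determined by its values on boxes, and a box of the plane pulls back
  to a product of two intervals.\<close>

lemma lborel_complex_eq_distr:
  "(lborel :: complex measure) = distr (lborel \<Otimes>\<^sub>M lborel) borel (\<lambda>(x, y). Complex x y)"
proof (rule lborel_eqI)
  have m: "(\<lambda>(x::real, y::real). Complex x y) \<in> borel_measurable (lborel \<Otimes>\<^sub>M lborel)"
    by (simp add: case_prod_unfold Complex_eq)
  fix a b :: complex
  assume ab: "\<And>e. e \<in> Basis \<Longrightarrow> a \<bullet> e \<le> b \<bullet> e"
  have le: "Re a \<le> Re b" "Im a \<le> Im b"
    using ab[of 1] ab[of \<i>] by (auto simp: Basis_complex_def inner_complex_def)
  have "(\<lambda>(x, y). Complex x y) -` box a b \<inter> space (lborel \<Otimes>\<^sub>M lborel) =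
      box (Re a) (Re b) \<times> box (Im a) (Im b)"
    by (auto simp: box_def Basis_complex_def inner_complex_def space_pair_measure)
  then show "emeasure (distr (lborel \<Otimes>\<^sub>M lborel) borel (\<lambda>(x, y). Complex x y)) (box a b) =
      (\<Prod>e\<in>Basis. (b - a) \<bullet> e)"
    using le m
    by (simp add: emeasure_distr lborel.emeasure_pair_measure_Times Basis_complex_def
        inner_complex_def ennreal_mult)
qed simp

lemma nn_integral_lborel_complex:
  assumes [measurable]: "f \<in> borel_measurable borel"
  shows "(\<integral>\<^sup>+z. f z \<partial>lborel) = (\<integral>\<^sup>+y. \<integral>\<^sup>+x. f (Complex x y) \<partial>lborel \<partial>lborel)"
    and "(\<integral>\<^sup>+z. f z \<partial>lborel) = (\<integral>\<^sup>+x. \<integral>\<^sup>+y. f (Complex x y) \<partial>lborel \<partial>lborel)"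
proof -
  have [measurable]: "(\<lambda>(x::real, y::real). Complex x y) \<in> borel_measurable (lborel \<Otimes>\<^sub>M lborel)"
    by (simp add: case_prod_unfold Complex_eq)
  have "(\<integral>\<^sup>+z. f z \<partial>lborel) = (\<integral>\<^sup>+p. f (case p of (x, y) \<Rightarrow> Complex x y) \<partial>(lborel \<Otimes>\<^sub>M lborel))"
    by (subst lborel_complex_eq_distr, subst nn_integral_distr) simp_all
  then have eq: "(\<integral>\<^sup>+z. f z \<partial>lborel) = (\<integral>\<^sup>+(x, y). f (Complex x y) \<partial>(lborel \<Otimes>\<^sub>M lborel))"
    by (simp add: case_prod_unfold)
  have [measurable]: "(\<lambda>(x, y). f (Complex x y)) \<in> borel_measurable (lborel \<Otimes>\<^sub>M lborel)"
    by (simp add: case_prod_unfold Complex_eq)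
  show "(\<integral>\<^sup>+z. f z \<partial>lborel) = (\<integral>\<^sup>+x. \<integral>\<^sup>+y. f (Complex x y) \<partial>lborel \<partial>lborel)"
    unfolding eq by (subst lborel.nn_integral_fst[symmetric]) simp_all
  show "(\<integral>\<^sup>+z. f z \<partial>lborel) = (\<integral>\<^sup>+y. \<integral>\<^sup>+x. f (Complex x y) \<partial>lborel \<partial>lborel)"
    unfolding eq by (subst lborel_pair.nn_integral_snd[symmetric]) simp_all
qed

text \<open>On each horizontal line the shear is a translation, which leaves the inner integral
  unchanged.\<close>

lemma nn_integral_shear_Re:
  assumes [measurable]: "f \<in> borel_measurable borel"
  shows "(\<integral>\<^sup>+z. f (z + of_real (p * Im z)) \<partial>lborel) = (\<integral>\<^sup>+z. f z \<partial>(lborel :: complex measure))"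
proof -
  have "Complex x y + of_real (p * y) = Complex (p * y + 1 * x) y" for x y
    by (simp add: complex_eq_iff)
  moreover have "(\<integral>\<^sup>+x. f (Complex (p * y + 1 * x) y) \<partial>lborel) = (\<integral>\<^sup>+x. f (Complex x y) \<partial>lborel)" for y
    by (subst nn_integral_real_affine[of _ 1 "p * y"]) (simp_all add: Complex_eq)
  ultimately show ?thesis
    by (subst (1 2) nn_integral_lborel_complex(1)) simp_all
qed

lemma nn_integral_shear_Im:
  assumes [measurable]: "f \<in> borel_measurable borel"
  shows "(\<integral>\<^sup>+z. f (z + \<i> * of_real (p * Re z)) \<partial>lborel) = (\<integral>\<^sup>+z. f z \<partial>(lborel :: complex measure))"
proof -
  have "Complex x y + \<i> * of_real (p * x) = Complex x (p * x + 1 * y)" for x y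
    by (simp add: complex_eq_iff)
  moreover have "(\<integral>\<^sup>+y. f (Complex x (p * x + 1 * y)) \<partial>lborel) = (\<integral>\<^sup>+y. f (Complex x y) \<partial>lborel)" for x
    by (subst nn_integral_real_affine[of _ 1 "p * x"]) (simp_all add: Complex_eq)
  ultimately show ?thesis
    by (subst (1 2) nn_integral_lborel_complex(2)) simp_all
qed

text \<open>A rotation by an angle that is not a multiple of \<open>\<pi>\<close> is a product of three shears.\<close>

lemma nn_integral_rotate_complex_aux:
  assumes w: "cmod w = 1" "Im w \<noteq> 0" and f [measurable]: "f \<in> borel_measurable borel"
  shows "(\<integral>\<^sup>+z. f (w * z) \<partial>lborel) = (\<integral>\<^sup>+z. f z \<partial>(lborel :: complex measure))"
proof -
  \<comment> \<open>For \<open>w = cis \<theta>\<close> this is \<open>- tan (\<theta> / 2)\<close>,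
    the slope of the two outer shears; the middle one has slope \<open>Im w\<close>.\<close>
  define p where "p = (Re w - 1) / Im w"
  have "(Re w)\<^sup>2 + (Im w)\<^sup>2 = 1"
    using w by (simp add: cmod_def)
  then have "(Re w + 1) * (Re w - 1) = - Im w * Im w"
    by (simp add: algebra_simps power2_eq_square)
  then have *: "(Re w + 1) * p = - Im w"
    using w unfolding p_def by (metis nonzero_mult_div_cancel_right times_divide_eq_right)
  then have p: "1 + p * Im w = Re w" "Re w * p + p = - Im w"
    using w * by (simp add: p_def, simp add: distrib_right)
  define g where "g z = f (z + of_real (p * Im z))" for z
  define h where "h z = g (z + \<i> * of_real (Im w * Re z))" for z
  have [measurable]: "g \<in> borel_measurable borel" "h \<in> borel_measurable borel"
    unfolding g_def h_def by measurable
  have "f (w * z) = h (z + of_real (p * Im z))" for z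
  proof -
    have "w * z = (let u = z + of_real (p * Im z); v = u + \<i> * of_real (Im w * Re u)
        in v + of_real (p * Im v))"
    proof -
      have 1: "Re z + p * Im z + p * (Im z + Im w * (Re z + p * Im z)) = Re w * Re z - Im w * Im z"
      proof -
        have "Re z + p * Im z + p * (Im z + Im w * (Re z + p * Im z))
            = (1 + p * Im w) * Re z + ((1 + p * Im w) * p + p) * Im z"
          by (simp add: algebra_simps)
        then show ?thesis unfolding p by simp
      qed
      have 2: "Im z + Im w * (Re z + p * Im z) = Re w * Im z + Im w * Re z"
      proof -
        have "Im z + Im w * (Re z + p * Im z) = (1 + p * Im w) * Im z + Im w * Re z"
          by (simp add: algebra_simps)
        then show ?thesis unfolding p by simp
      qed
      show ?thesis
        using 1 2 by (simp add: complex_eq_iff Let_def)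
    qed
    then show ?thesis
      by (simp add: g_def h_def Let_def)
  qed
  then have "(\<integral>\<^sup>+z. f (w * z) \<partial>lborel) = (\<integral>\<^sup>+z. h (z + of_real (p * Im z)) \<partial>lborel)"
    by simp
  also have "\<dots> = (\<integral>\<^sup>+z. h z \<partial>lborel)"
    by (rule nn_integral_shear_Re) simp
  also have "\<dots> = (\<integral>\<^sup>+z. g z \<partial>lborel)"
    unfolding h_def by (rule nn_integral_shear_Im) simp
  also have "\<dots> = (\<integral>\<^sup>+z. f z \<partial>lborel)"
    unfolding g_def by (rule nn_integral_shear_Re) simp
  finally show ?thesis .
qed

lemma nn_integral_rotate_complex:
  assumes w: "cmod w = 1" and f [measurable]: "f \<in> borel_measurable borel"
  shows "(\<integral>\<^sup>+z. f (w * z) \<partial>lborel) = (\<integral>\<^sup>+z. f z \<partial>(lborel :: complex measure))"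
proof (cases "Im w = 0")
  case False
  then show ?thesis using nn_integral_rotate_complex_aux w f by blast
next
  case True
  \<comment> \<open>Here \<open>w\<close> is 1 or -1. Both \<open>\<i>\<close> and
    \<open>- \<i> * w\<close> have nonzero imaginary part, so the rotation is split into these
    two.\<close>
  have "(\<integral>\<^sup>+z. f (w * z) \<partial>lborel) = (\<integral>\<^sup>+z. f (\<i> * (- \<i> * w * z)) \<partial>lborel)"
    by (simp add: mult.assoc[symmetric])
  also have "\<dots> = (\<integral>\<^sup>+z. f (\<i> * z) \<partial>lborel)"
    using w True
    by (intro nn_integral_rotate_complex_aux[of "- \<i> * w" "\<lambda>z. f (\<i> * z)"])
       (auto simp: norm_mult cmod_def)
  also have "\<dots> = (\<integral>\<^sup>+z. f z \<partial>lborel)"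
    by (intro nn_integral_rotate_complex_aux) auto
  finally show ?thesis .
qed

lemma distr_lborel_rotate:
  assumes "cmod w = 1"
  shows "distr lborel lborel ((*) w) = (lborel :: complex measure)"
proof (rule measure_eqI)
  fix A :: "complex set"
  assume "A \<in> sets (distr lborel lborel ((*) w))"
  then have [measurable]: "A \<in> sets borel" by simp
  have "emeasure (distr lborel lborel ((*) w)) A = (\<integral>\<^sup>+z. indicator A z \<partial>distr lborel lborel ((*) w))"
    by (subst nn_integral_indicator) auto
  also have "\<dots> = (\<integral>\<^sup>+z. indicator A (w * z) \<partial>lborel)"
    by (subst nn_integral_distr) auto
  also have "\<dots> = (\<integral>\<^sup>+z. indicator A z \<partial>lborel)"
    using assms by (intro nn_integral_rotate_complex) auto
  finally show "emeasure (distr lborel lborel ((*) w)) A = emeasure lborel A"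
    by simp
qed simp

section \<open>Translations and the passage to product measures\<close>

lemma distr_lborel_translate:
  "distr lborel lborel ((+) a) = (lborel :: complex measure)"
  using lborel_distr_plus[of a] by (simp cong: distr_cong)

text \<open>A product measure is determined by boxes, and the preimage of a box under a
  componentwise map is the box of the preimages.\<close>

lemma distr_PiM_componentwise:
  assumes M: "sigma_finite_measure M" and T: "distr M M T = M" "T \<in> M \<rightarrow>\<^sub>M M" and I: "finite I"
  shows "distr (PiM I (\<lambda>_. M)) (PiM I (\<lambda>_. M)) (\<lambda>z. \<lambda>i\<in>I. T (z i)) = PiM I (\<lambda>_. M)"
proof -
  interpret sigma_finite_measure M by fact
  interpret product_sigma_finite "\<lambda>_::'b. M" by standard
  note T(2)[measurable]
  have m [measurable]: "(\<lambda>z. \<lambda>i\<in>I. T (z i)) \<in> PiM I (\<lambda>_. M) \<rightarrow>\<^sub>M PiM I (\<lambda>_. M)"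
    by measurable
  show ?thesis
  proof (rule PiM_eqI)
    fix A assume A: "\<And>i. i \<in> I \<Longrightarrow> A i \<in> sets M"
    have "(\<lambda>z. \<lambda>i\<in>I. T (z i)) -` Pi\<^sub>E I A \<inter> space (PiM I (\<lambda>_. M)) = Pi\<^sub>E I (\<lambda>i. T -` A i \<inter> space M)"
      by (auto simp: space_PiM PiE_iff)
    moreover have "T -` A i \<inter> space M \<in> sets M" if "i \<in> I" for i
      using A[OF that] by measurable
    moreover have "emeasure M (T -` A i \<inter> space M) = emeasure M (A i)" if "i \<in> I" for i
      using emeasure_distr[OF T(2) A[OF that]] T(1) by simp
    ultimately show "emeasure (distr (PiM I (\<lambda>_. M)) (PiM I (\<lambda>_. M)) (\<lambda>z. \<lambda>i\<in>I. T (z i))) (Pi\<^sub>E I A)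
        = (\<Prod>i\<in>I. emeasure M (A i))"
      using A I by (simp add: emeasure_distr emeasure_PiM sets_PiM_I_finite)
  qed (use I in auto)
qed

lemma nn_integral_PiM_componentwise:
  assumes "sigma_finite_measure M" "distr M M T = M" "T \<in> M \<rightarrow>\<^sub>M M" "finite I"
    and f: "f \<in> borel_measurable (PiM I (\<lambda>_. M))"
  shows "(\<integral>\<^sup>+z. f (\<lambda>i\<in>I. T (z i)) \<partial>PiM I (\<lambda>_. M)) = (\<integral>\<^sup>+z. f z \<partial>PiM I (\<lambda>_. M))"
proof -
  note assms(3)[measurable]
  have m: "(\<lambda>z. \<lambda>i\<in>I. T (z i)) \<in> PiM I (\<lambda>_. M) \<rightarrow>\<^sub>M PiM I (\<lambda>_. M)"
    by measurable
  have "(\<integral>\<^sup>+z. f (\<lambda>i\<in>I. T (z i)) \<partial>PiM I (\<lambda>_. M)) =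
      (\<integral>\<^sup>+z. f z \<partial>distr (PiM I (\<lambda>_. M)) (PiM I (\<lambda>_. M)) (\<lambda>z. \<lambda>i\<in>I. T (z i)))"
    using m f by (simp add: nn_integral_distr)
  then show ?thesis
    using distr_PiM_componentwise[OF assms(1-4)] by simp
qed

text \<open>The box with sides \<open>A i\<close> pulls back to the box with sides
  \<open>A (inv s i)\<close>, and the two products of side measures differ only in the order of the
  factors.\<close>

lemma nn_integral_PiM_permute:
  assumes M: "sigma_finite_measure M" and I: "finite I" and s: "s permutes I"
    and f: "f \<in> borel_measurable (PiM I (\<lambda>_. M))"
  shows "(\<integral>\<^sup>+z. f (z \<circ> s) \<partial>PiM I (\<lambda>_. M)) = (\<integral>\<^sup>+z. f z \<partial>PiM I (\<lambda>_. M))"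
proof -
  interpret sigma_finite_measure M by fact
  interpret product_sigma_finite "\<lambda>_::'b. M" by standard
  have sI: "s i \<in> I \<longleftrightarrow> i \<in> I" for i
    using permutes_in_image[OF s] .
  have m: "(\<lambda>z. z \<circ> s) \<in> PiM I (\<lambda>_. M) \<rightarrow>\<^sub>M PiM I (\<lambda>_. M)"
  proof (rule measurable_PiM_single')
    show "(\<lambda>z. (z \<circ> s) i) \<in> PiM I (\<lambda>_. M) \<rightarrow>\<^sub>M M" if "i \<in> I" for i
      using that sI by (simp add: measurable_component_singleton)
  qed (use sI in \<open>auto simp: space_PiM PiE_iff extensional_def\<close>)
  have "distr (PiM I (\<lambda>_. M)) (PiM I (\<lambda>_. M)) (\<lambda>z. z \<circ> s) = PiM I (\<lambda>_. M)"
  proof (rule PiM_eqI)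
    fix A assume A: "\<And>i. i \<in> I \<Longrightarrow> A i \<in> sets M"
    have inv: "inv s i \<in> I \<longleftrightarrow> i \<in> I" for i
      using permutes_in_image[OF permutes_inv[OF s]] .
    have "(z \<circ> s) \<in> Pi\<^sub>E I A \<longleftrightarrow> z \<in> Pi\<^sub>E I (\<lambda>i. A (inv s i))" if "z \<in> space (PiM I (\<lambda>_. M))" for z
    proof -
      have "(\<forall>i\<in>I. z (s i) \<in> A i) \<longleftrightarrow> (\<forall>i\<in>I. z i \<in> A (inv s i))"
        using permutes_inverses[OF s] sI inv by metis
      then show ?thesis
        using that sI by (auto simp: space_PiM PiE_iff extensional_def)
    qed
    moreover have "z \<in> space (PiM I (\<lambda>_. M))" if "z \<in> Pi\<^sub>E I (\<lambda>i. A (inv s i))" for z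
    proof -
      have "z i \<in> space M" if "i \<in> I" for i
        using \<open>z \<in> Pi\<^sub>E I _\<close> A[of "inv s i"] inv[of i] that sets.sets_into_space by (auto simp: PiE_iff)
      then show ?thesis
        using that by (auto simp: space_PiM PiE_iff)
    qed
    ultimately have "(\<lambda>z. z \<circ> s) -` Pi\<^sub>E I A \<inter> space (PiM I (\<lambda>_. M)) = Pi\<^sub>E I (\<lambda>i. A (inv s i))"
      by auto
    then have "emeasure (distr (PiM I (\<lambda>_. M)) (PiM I (\<lambda>_. M)) (\<lambda>z. z \<circ> s)) (Pi\<^sub>E I A)
        = (\<Prod>i\<in>I. emeasure M (A (inv s i)))"
      using A I inv m by (simp add: emeasure_distr emeasure_PiM sets_PiM_I_finite)
    also have "\<dots> = (\<Prod>i\<in>I. emeasure M (A i))"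
      using prod.permute[OF permutes_inv[OF s], of "\<lambda>i. emeasure M (A i)"] by (simp add: o_def)
    finally show "emeasure (distr (PiM I (\<lambda>_. M)) (PiM I (\<lambda>_. M)) (\<lambda>z. z \<circ> s)) (Pi\<^sub>E I A)
        = (\<Prod>i\<in>I. emeasure M (A i))" .
  qed (use I in auto)
  then show ?thesis
    using nn_integral_distr[OF m, of f] f by simp
qed

section \<open>Exponents and Gaussian moments\<close>

text \<open>The term with \<open>W\<close> in the proof is the strengthening needed for an induction that removes the
  largest exponent: \<open>W\<close> stands for a lower bound of the slopes of the tangents to \<open>y \<mapsto> x\<^sup>y\<close>
  at the points \<open>m i\<close>, taken with positive sign.\<close>

lemma sum_power_le_of_subset_sums:
  fixes m :: "'a \<Rightarrow> nat" and x :: real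
  assumes "finite A" and m: "\<And>S. S \<subseteq> A \<Longrightarrow> l * (card S choose 2) \<le> sum m S" and x: "0 < x" "x < 1"
  shows "(\<Sum>i\<in>A. x ^ m i) \<le> (\<Sum>j<card A. x ^ (l * j))"
proof -
  have "\<forall>W. 0 \<le> W \<longrightarrow> (\<forall>i\<in>A. W \<le> x ^ m i * (- ln x)) \<longrightarrow>
      (\<Sum>i\<in>A. x ^ m i) + W * (real (sum m A) - real (l * (card A choose 2))) \<le> (\<Sum>j<card A. x ^ (l * j))"
    using \<open>finite A\<close> m
  proof (induction A rule: finite_ranking_induct[where f = m])
    case empty
    then show ?case by simp
  next
    case (insert a S)
    show ?case
    \<comment> \<open>The ranking induction makes the exponent of \<open>a\<close> largest but
      allows \<open>a\<close> to lie in \<open>S\<close> already.\<close>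
    proof (cases "a \<in> S")
      case True
      then show ?thesis using insert by (simp add: insert_absorb)
    next
      case False
      \<comment> \<open>The steepness of \<open>y \<mapsto> x ^ y\<close> at the largest exponent.
        It is the smallest one occurring, so the induction hypothesis for \<open>S\<close> may be
        used with \<open>W = w\<close>.\<close>
      define w where "w = x ^ m a * (- ln x)"
      have w: "0 \<le> w"
        using x by (simp add: w_def mult_nonneg_nonpos)
      have wle: "w \<le> x ^ m i * (- ln x)" if "i \<in> S" for i
        unfolding w_def using insert.hyps(2)[OF that] x
        by (intro mult_right_mono power_decreasing) auto
      have IH: "(\<Sum>i\<in>S. x ^ m i) + w * (real (sum m S) - real (l * (card S choose 2))) \<le> (\<Sum>j<card S. x ^ (l * j))"
        using insert.IH insert.prems w wle by blast
      \<comment> \<open>Convexity: the tangent at \<open>m a\<close>, evaluated at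
        \<open>l * card S\<close>, lies below the curve. The point \<open>l * card S\<close> is the
        next exponent in the extremal sequence 0, l, 2l, and so on.\<close>
      have tangent: "x ^ m a + w * (real (m a) - real (l * card S)) \<le> x ^ (l * card S)"
      proof -
        have "x ^ m a * (1 + (real (l * card S) - real (m a)) * ln x)
            \<le> x ^ m a * exp ((real (l * card S) - real (m a)) * ln x)"
          using x by (intro mult_left_mono exp_ge_add_one_self) auto
        also have "\<dots> = x ^ (l * card S)"
        proof -
          have "exp (real k * ln x) = x ^ k" for k
            using x by (simp add: exp_of_nat_mult)
          from this[of "m a"] this[of "l * card S"] show ?thesis
            using x by (simp add: left_diff_distrib exp_diff)
        qed
        finally show ?thesis
          by (simp add: w_def algebra_simps)
      qed
      have c: "card (insert a S) = Suc (card S)" "Suc (card S) choose 2 = (card S choose 2) + card S"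
        using insert.hyps False by (simp_all add: numeral_2_eq_2)
      \<comment> \<open>The excess over the minimal sum is nonnegative, so replacing
        \<open>w\<close> by a smaller \<open>W\<close> only weakens the inequality.\<close>
      have D: "0 \<le> real (sum m (insert a S)) - real (l * (card (insert a S) choose 2))"
        using insert.prems(1)[OF subset_refl] by (simp only: diff_ge_0_iff_ge of_nat_le_iff)
      have "(\<Sum>i\<in>insert a S. x ^ m i)
          + w * (real (sum m (insert a S)) - real (l * (card (insert a S) choose 2)))
          \<le> (\<Sum>j<card (insert a S). x ^ (l * j))"
        using IH tangent insert.hyps False unfolding c by (simp add: algebra_simps)
      moreover have "W * (real (sum m (insert a S)) - real (l * (card (insert a S) choose 2)))
          \<le> w * (real (sum m (insert a S)) - real (l * (card (insert a S) choose 2)))"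
        if "W \<le> w" for W
        using that D by (rule mult_right_mono)
      ultimately show ?thesis
        unfolding w_def by fastforce
    qed
  qed
  \<comment> \<open>The choice \<open>W = 0\<close> removes the auxiliary term.\<close>
  then show ?thesis
    using x by (auto dest!: spec[of _ 0] simp: mult_nonneg_nonpos)
qed

text \<open>Bernoulli's inequality gives \<open>x ^ l \<le> 1 / (1 + l * t)\<close>, and the finite
  sum is at most the full geometric series. The bound is uniform in \<open>n\<close>, hence in the
  number of particles.\<close>

lemma inverse_power_geometric_le:
  fixes t :: real
  assumes t: "0 < t" and l: "1 \<le> l"
  defines "x \<equiv> 1 / (1 + t)"
  shows "x * (\<Sum>j<n. x ^ (l * j)) \<le> (1 + real l * t) / (real l * t)"
proof -
  have x: "0 < x" "x < 1"
    using t by (auto simp: x_def)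
  have "1 + real l * t \<le> (1 + t) ^ l"
    using Bernoulli_inequality[of t l] t by simp
  then have xl: "x ^ l \<le> 1 / (1 + real l * t)"
    using t by (simp add: x_def power_divide frac_le add_pos_nonneg)
  have lt: "0 < real l * t" using t l by simp
  then have less: "x ^ l < 1"
    using xl by (smt (verit, best) divide_less_eq_1_pos)
  have "(\<Sum>j<n. x ^ (l * j)) = (1 - (x ^ l) ^ n) / (1 - x ^ l)"
    using less by (simp add: power_mult sum_gp_strict)
  also have "\<dots> \<le> 1 / (1 - x ^ l)"
    using less x by (intro divide_right_mono) auto
  also have "\<dots> \<le> 1 / (1 - 1 / (1 + real l * t))"
    using xl lt by (intro divide_left_mono mult_pos_pos) (auto simp: less)
  also have "\<dots> = (1 + real l * t) / (real l * t)"
    using lt by (simp add: field_simps)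
  finally have "(\<Sum>j<n. x ^ (l * j)) \<le> (1 + real l * t) / (real l * t)" .
  moreover have "0 \<le> (\<Sum>j<n. x ^ (l * j))"
    using x by (intro sum_nonneg) auto
  ultimately show ?thesis
    using x by (smt (verit) mult_left_le_one_le)
qed

section \<open>Gaussian integrals and moments\<close>

lemma nn_integral_gaussian_real:
  assumes "s > 0"
  shows "(\<integral>\<^sup>+x. ennreal (exp (- s * x\<^sup>2)) \<partial>lborel) = ennreal (sqrt (pi / s))"
proof -
  \<comment> \<open>The standard deviation for which the normal density has exponent
    \<open>- s * x\<^sup>2\<close>.\<close>
  define \<sigma> where "\<sigma> = 1 / sqrt (2 * s)"
  have \<sigma>: "\<sigma> > 0" "2 * \<sigma>\<^sup>2 = 1 / s" "2 * pi * \<sigma>\<^sup>2 = pi / s"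
    using assms by (auto simp: \<sigma>_def power_divide)
  have "exp (- s * x\<^sup>2) = sqrt (pi / s) * normal_density 0 \<sigma> x" for x
    using assms \<sigma> by (simp add: normal_density_def mult.commute)
  then have "(\<integral>\<^sup>+x. ennreal (exp (- s * x\<^sup>2)) \<partial>lborel)
      = (\<integral>\<^sup>+x. ennreal (sqrt (pi / s)) * ennreal (normal_density 0 \<sigma> x) \<partial>lborel)"
    using assms by (simp add: ennreal_mult)
  also have "\<dots> = ennreal (sqrt (pi / s)) * (\<integral>\<^sup>+x. ennreal (normal_density 0 \<sigma> x) \<partial>lborel)"
    by (intro nn_integral_cmult) simp
  also have "(\<integral>\<^sup>+x. ennreal (normal_density 0 \<sigma> x) \<partial>lborel) = 1"
    using \<sigma> by (subst nn_integral_eq_integral) auto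
  finally show ?thesis by simp
qed

lemma nn_integral_gaussian_complex:
  assumes "s > 0"
  shows "(\<integral>\<^sup>+z. ennreal (exp (- s * (cmod z)\<^sup>2)) \<partial>lborel) = ennreal (pi / s)"
proof -
  have "exp (- s * (cmod z)\<^sup>2) = (\<Prod>b\<in>Basis. exp (- s * (z \<bullet> b)\<^sup>2))" for z
    by (simp add: Basis_complex_def inner_complex_def cmod_power2 exp_add[symmetric] algebra_simps)
  then have "(\<integral>\<^sup>+z. ennreal (exp (- s * (cmod z)\<^sup>2)) \<partial>lborel)
      = (\<Prod>b\<in>(Basis :: complex set). \<integral>\<^sup>+x. ennreal (exp (- s * x\<^sup>2)) \<partial>lborel)"
    by (subst nn_integral_lborel_prod[symmetric]) (auto simp: prod_ennreal)
  also have "\<dots> = ennreal (pi / s)"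
    using assms
    by (subst nn_integral_gaussian_real) (auto simp: Basis_complex_def ennreal_mult[symmetric])
  finally show ?thesis .
qed

lemma power_div_fact_le_exp:
  fixes y :: real
  assumes "0 \<le> y"
  shows "y ^ k / fact k \<le> exp y"
proof -
  have "(\<Sum>n\<in>{k}. y ^ n /\<^sub>R fact n) \<le> (\<Sum>n. y ^ n /\<^sub>R fact n)"
    using assms sums_summable[OF exp_converges[of y]] by (intro sum_le_suminf) auto
  then show ?thesis
    using sums_unique[OF exp_converges[of y]] by (simp add: divide_inverse mult.commute)
qed

text \<open>Half of the Gaussian decay absorbs the polynomial growth, by
  \<open>y ^ k \<le> fact k * exp y\<close> with \<open>y = s * u\<^sup>2 / 2\<close>.\<close>

lemma integrable_gaussian_moment:
  assumes "s > 0"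
  shows "integrable lborel (\<lambda>z :: complex. z ^ a * cnj z ^ b * of_real (exp (- s * (cmod z)\<^sup>2)))"
proof -
  define k where "k = a + b"
  define C where "C = 1 + fact k * (2 / s) ^ k"
  have C: "0 \<le> C"
    using assms by (auto simp: C_def intro!: add_nonneg_nonneg mult_nonneg_nonneg)
  have bound: "u ^ k * exp (- s * u\<^sup>2) \<le> C * exp (- (s / 2) * u\<^sup>2)" if u: "0 \<le> u" for u :: real
  proof -
    define y where "y = s * u\<^sup>2 / 2"
    have y: "0 \<le> y" using assms by (simp add: y_def)
    \<comment> \<open>The total degree \<open>k\<close> may be odd, whereas powers of
      \<open>y\<close> only supply even powers of \<open>u\<close>.\<close>
    have "u ^ k \<le> 1 + u ^ (2 * k)"
    proof (cases "u \<le> 1")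
      case True
      then have "u ^ k \<le> 1" using u by (simp add: power_le_one)
      then show ?thesis using u by (smt (verit) zero_le_power)
    next
      case False
      then have "u ^ k \<le> u ^ (2 * k)" by (intro power_increasing) auto
      then show ?thesis by simp
    qed
    also have "u ^ (2 * k) = (2 / s) ^ k * y ^ k"
      using assms by (simp add: y_def power_mult power_mult_distrib[symmetric])
    also have "\<dots> \<le> (2 / s) ^ k * (fact k * exp y)"
      using power_div_fact_le_exp[OF y, of k] assms
      by (intro mult_left_mono) (auto simp: field_simps)
    finally have "u ^ k \<le> 1 + fact k * (2 / s) ^ k * exp y"
      by (simp add: mult_ac)
    also have "\<dots> \<le> C * exp y"
      using y by (simp add: C_def algebra_simps)
    finally have "u ^ k * exp (- 2 * y) \<le> C * exp y * exp (- 2 * y)"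
      by (intro mult_right_mono) auto
    also have "\<dots> = C * exp (- y)"
      by (simp add: mult.assoc exp_add[symmetric])
    finally show ?thesis
      by (simp add: y_def)
  qed
  show ?thesis
  proof (rule Bochner_Integration.integrable_bound)
    show "integrable lborel (\<lambda>z :: complex. C * exp (- (s / 2) * (cmod z)\<^sup>2))"
      using nn_integral_gaussian_complex[of "s / 2"] assms
      by (intro integrable_mult_right integrableI_nonneg) auto
    show "AE z in lborel. norm (z ^ a * cnj z ^ b * of_real (exp (- s * (cmod z)\<^sup>2)))
        \<le> norm (C * exp (- (s / 2) * (cmod z)\<^sup>2))"
      using bound C by (simp add: norm_mult norm_power k_def power_add abs_mult)
    have "(\<lambda>z. cnj z) \<in> borel_measurable borel"
      by (intro borel_measurable_continuous_onI continuous_intros)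
    then show "(\<lambda>z :: complex. z ^ a * cnj z ^ b * of_real (exp (- s * (cmod z)\<^sup>2))) \<in> borel_measurable lborel"
      by measurable
  qed
qed

text \<open>The squared norm of the monomial \<open>z ^ k\<close> for the weight
  \<open>exp (- s * (cmod z)\<^sup>2)\<close>.\<close>

definition gaussian_moment :: "nat \<Rightarrow> real \<Rightarrow> real" where
  "gaussian_moment k s = (\<integral>z. cmod z ^ (2 * k) * exp (- s * (cmod z)\<^sup>2) \<partial>lborel)"

lemma gaussian_moment_nonneg: "0 \<le> gaussian_moment k s"
  unfolding gaussian_moment_def by (rule Bochner_Integration.integral_nonneg) simp

text \<open>Rescaling by \<open>1 / sqrt s\<close> gives \<open>(1 / s) ^ k\<close> from the
  monomial and one further factor from the Jacobian in two real dimensions.\<close>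

lemma gaussian_moment_scale:
  assumes s: "s > 0"
  shows "gaussian_moment k s = (1 / s) ^ Suc k * gaussian_moment k 1"
proof -
  define c where "c = 1 / sqrt s"
  define g where "g z = cmod z ^ (2 * k) * exp (- s * (cmod z)\<^sup>2)" for z
  have [measurable]: "g \<in> borel_measurable borel"
    unfolding g_def by measurable
  have c: "c > 0" "c\<^sup>2 = 1 / s"
    using s by (auto simp: c_def power_divide)
  have "gaussian_moment k s = (\<integral>z. g z \<partial>density (distr lborel borel (\<lambda>z. 0 + c *\<^sub>R z)) (\<lambda>_. \<bar>c\<bar> ^ DIM(complex)))"
    using lborel_affine[of c "0 :: complex"] c by (simp add: gaussian_moment_def g_def)
  also have "\<dots> = (\<integral>z. c\<^sup>2 *\<^sub>R g (c *\<^sub>R z) \<partial>lborel)"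
    using s c by (subst integral_density) (auto simp: integral_distr)
  also have "\<dots> = (\<integral>z. (1 / s) ^ Suc k * (cmod z ^ (2 * k) * exp (- 1 * (cmod z)\<^sup>2)) \<partial>lborel)"
    using s c by (intro Bochner_Integration.integral_cong)
      (auto simp: g_def power_mult_distrib power_mult power_divide)
  finally show ?thesis
    by (simp add: gaussian_moment_def)
qed

text \<open>For distinct exponents, some rotation multiplies the integral by a factor other than 1.\<close>

lemma integral_gaussian_monomials:
  assumes s: "s > 0"
  shows "(\<integral>z. z ^ a * cnj z ^ b * of_real (exp (- s * (cmod z)\<^sup>2)) \<partial>lborel) =
      (if a = b then of_real (gaussian_moment a s) else 0)"
proof (cases "a = b")
  case True
  have "z ^ a * cnj z ^ a * of_real (exp (- s * (cmod z)\<^sup>2)) =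
      complex_of_real (cmod z ^ (2 * a) * exp (- s * (cmod z)\<^sup>2))" for z
    by (simp add: power_mult_distrib[symmetric] complex_norm_square[symmetric] power_mult)
  then show ?thesis
    using True unfolding gaussian_moment_def by (simp del: of_real_mult of_real_exp of_real_power)
next
  case False
  define g where "g z = z ^ a * cnj z ^ b * of_real (exp (- s * (cmod z)\<^sup>2))" for z :: complex
  have "(\<lambda>z. cnj z) \<in> borel_measurable borel"
    by (intro borel_measurable_continuous_onI continuous_intros)
  then have [measurable]: "g \<in> borel_measurable borel"
    unfolding g_def by measurable
  \<comment> \<open>The angle is chosen so that the two powers combine to
    \<open>cis pi = - 1\<close>; the integral then equals its own negative.\<close>
  define w where "w = cis (pi / (real a - real b))"
  have w: "cmod w = 1"
    by (simp add: w_def)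
  have "w ^ a * cnj w ^ b = cis ((real a - real b) * (pi / (real a - real b)))"
    unfolding w_def cis_cnj Complex.DeMoivre cis_mult by (simp add: algebra_simps diff_divide_distrib)
  also have "\<dots> = - 1"
    using False by simp
  finally have ww: "w ^ a * cnj w ^ b = - 1" .
  have "(\<integral>z. g z \<partial>lborel) = (\<integral>z. g z \<partial>distr lborel lborel ((*) w))"
    using distr_lborel_rotate[OF w] by simp
  also have "\<dots> = (\<integral>z. g (w * z) \<partial>lborel)"
    by (subst integral_distr) auto
  also have "\<dots> = (\<integral>z. (w ^ a * cnj w ^ b) * g z \<partial>lborel)"
    using w by (intro Bochner_Integration.integral_cong)
      (auto simp: g_def power_mult_distrib norm_mult)
  also have "\<dots> = - (\<integral>z. g z \<partial>lborel)"
    unfolding ww by simp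
  finally show ?thesis
    using False by (simp add: g_def)
qed

section \<open>Polynomials with a prescribed order of vanishing\<close>

text \<open>The number \<open>b S\<close> bounds from below the order to which the monomial vanishes
  where all variables with index in \<open>S\<close> vanish. Exponents are total functions, zero
  from \<open>N\<close> on, so that they add pointwise.\<close>

definition staircase :: "nat \<Rightarrow> (nat set \<Rightarrow> nat) \<Rightarrow> (nat \<Rightarrow> nat) set" where
  "staircase N b = {m. (\<forall>i\<ge>N. m i = 0) \<and> (\<forall>S\<subseteq>{..<N}. b S \<le> sum m S)}"

definition polys :: "nat \<Rightarrow> (nat set \<Rightarrow> nat) \<Rightarrow> ((nat \<Rightarrow> complex) \<Rightarrow> complex) set" where
  "polys N b = {h. \<exists>M c. finite M \<and> M \<subseteq> staircase N b \<and> h = (\<lambda>z. \<Sum>m\<in>M. c m * (\<Prod>i<N. z i ^ m i))}"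

lemma polys_mono:
  assumes "h \<in> polys N b" "\<And>S. S \<subseteq> {..<N} \<Longrightarrow> b' S \<le> b S"
  shows "h \<in> polys N b'"
proof -
  have "staircase N b \<subseteq> staircase N b'"
    using assms(2) unfolding staircase_def by (smt (verit) Collect_mono_iff order_trans)
  then show ?thesis
    using assms(1) unfolding polys_def by blast
qed

lemma polys_monomial: "m \<in> staircase N b \<Longrightarrow> (\<lambda>z. c * (\<Prod>i<N. z i ^ m i)) \<in> polys N b"
  unfolding polys_def by (auto intro!: exI[of _ "{m}"] exI[of _ "\<lambda>_. c"])

lemma polys_add:
  assumes "g \<in> polys N b" "h \<in> polys N b"
  shows "(\<lambda>z. g z + h z) \<in> polys N b"
proof -
  obtain M c where g: "finite M" "M \<subseteq> staircase N b" "g = (\<lambda>z. \<Sum>m\<in>M. c m * (\<Prod>i<N. z i ^ m i))"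
    using assms(1) unfolding polys_def by blast
  obtain M' c' where h: "finite M'" "M' \<subseteq> staircase N b" "h = (\<lambda>z. \<Sum>m\<in>M'. c' m * (\<Prod>i<N. z i ^ m i))"
    using assms(2) unfolding polys_def by blast
  define d where "d m = (if m \<in> M then c m else 0) + (if m \<in> M' then c' m else 0)" for m
  have "g z + h z = (\<Sum>m\<in>M \<union> M'. d m * (\<Prod>i<N. z i ^ m i))" for z
  proof -
    have "g z = (\<Sum>m\<in>M \<union> M'. (if m \<in> M then c m else 0) * (\<Prod>i<N. z i ^ m i))"
      unfolding g(3) using g(1) h(1) by (intro sum.mono_neutral_cong_left) auto
    moreover have "h z = (\<Sum>m\<in>M \<union> M'. (if m \<in> M' then c' m else 0) * (\<Prod>i<N. z i ^ m i))"
      unfolding h(3) using g(1) h(1) by (intro sum.mono_neutral_cong_left) auto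
    ultimately show ?thesis
      by (simp add: d_def distrib_right sum.distrib)
  qed
  then show ?thesis
    using g(1,2) h(1,2) unfolding polys_def by (auto intro!: exI[of _ "M \<union> M'"] exI[of _ d])
qed

lemma polys_zero: "(\<lambda>z. 0) \<in> polys N b"
  unfolding polys_def by (auto intro!: exI[of _ "{}"])

lemma polys_sum: "(\<And>k. k \<in> A \<Longrightarrow> h k \<in> polys N b) \<Longrightarrow> (\<lambda>z. \<Sum>k\<in>A. h k z) \<in> polys N b"
  by (induction A rule: infinite_finite_induct) (auto intro: polys_zero polys_add)

text \<open>Exponents add under multiplication, hence so do the lower bounds. Coinciding products of
  monomials are merged by closure under sums.\<close>

lemma polys_mult:
  assumes "g \<in> polys N b" "h \<in> polys N b'"
  shows "(\<lambda>z. g z * h z) \<in> polys N (\<lambda>S. b S + b' S)"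
proof -
  obtain M c where g: "finite M" "M \<subseteq> staircase N b" "g = (\<lambda>z. \<Sum>m\<in>M. c m * (\<Prod>i<N. z i ^ m i))"
    using assms(1) unfolding polys_def by blast
  obtain M' c' where h: "finite M'" "M' \<subseteq> staircase N b'" "h = (\<lambda>z. \<Sum>m\<in>M'. c' m * (\<Prod>i<N. z i ^ m i))"
    using assms(2) unfolding polys_def by blast
  have "(\<lambda>z. (c m * c' m') * (\<Prod>i<N. z i ^ (m i + m' i))) \<in> polys N (\<lambda>S. b S + b' S)"
    if "m \<in> M" "m' \<in> M'" for m m'
  proof -
    have "m \<in> staircase N b" "m' \<in> staircase N b'"
      using that g(2) h(2) by blast+
    then have "(\<lambda>i. m i + m' i) \<in> staircase N (\<lambda>S. b S + b' S)"
      by (auto simp: staircase_def sum.distrib intro!: add_mono)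
    then show ?thesis
      by (rule polys_monomial)
  qed
  then have "(\<lambda>z. \<Sum>m\<in>M. \<Sum>m'\<in>M'. (c m * c' m') * (\<Prod>i<N. z i ^ (m i + m' i))) \<in> polys N (\<lambda>S. b S + b' S)"
    by (intro polys_sum)
  moreover have "g z * h z = (\<Sum>m\<in>M. \<Sum>m'\<in>M'. (c m * c' m') * (\<Prod>i<N. z i ^ (m i + m' i)))" for z
    unfolding g(3) h(3) sum_product
    by (intro sum.cong refl) (simp add: power_add prod.distrib mult_ac)
  ultimately show ?thesis by simp
qed

lemma polys_const: "(\<lambda>z. c) \<in> polys N (\<lambda>_. 0)"
  using polys_monomial[of "\<lambda>_. 0" N "\<lambda>_. 0" c] by (simp add: staircase_def)

lemma polys_cmult: "h \<in> polys N b \<Longrightarrow> (\<lambda>z. c * h z) \<in> polys N b"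
  using polys_mult[OF polys_const] by fastforce

lemma polys_var:
  assumes "i < N" "\<And>S. b S \<le> (if i \<in> S then 1 else 0)"
  shows "(\<lambda>z. z i) \<in> polys N b"
proof -
  have "sum (\<lambda>j. if j = i then 1 else 0) S = (if i \<in> S then 1 else (0::nat))" if "S \<subseteq> {..<N}" for S
    using finite_subset[OF that] by simp
  then have "(\<lambda>z. 1 * (\<Prod>j<N. z j ^ (if j = i then 1 else 0))) \<in> polys N b"
    using assms by (intro polys_monomial) (auto simp: staircase_def)
  moreover have "(\<Prod>j<N. z j ^ (if j = i then 1 else 0)) = z i" for z :: "nat \<Rightarrow> complex"
    using assms(1) by (subst prod.remove[of _ i]) (auto intro!: prod.neutral)
  ultimately show ?thesis by simp
qed

lemma polys_power: "h \<in> polys N b \<Longrightarrow> (\<lambda>z. h z ^ n) \<in> polys N (\<lambda>S. n * b S)"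
proof (induction n)
  case 0
  then show ?case using polys_const[of 1] by simp
next
  case (Suc n)
  then show ?case using polys_mult[of h N b "\<lambda>z. h z ^ n" "\<lambda>S. n * b S"] by simp
qed

lemma polys_prod:
  assumes "finite A" "\<And>k. k \<in> A \<Longrightarrow> h k \<in> polys N (b k)"
  shows "(\<lambda>z. \<Prod>k\<in>A. h k z) \<in> polys N (\<lambda>S. \<Sum>k\<in>A. b k S)"
  using assms
proof (induction A rule: finite_induct)
  case empty
  then show ?case using polys_const[of 1] by simp
next
  case (insert k A)
  then show ?case
    using polys_mult[of "h k" N "b k" "\<lambda>z. \<Prod>k\<in>A. h k z" "\<lambda>S. \<Sum>k\<in>A. b k S"] by simp
qed

text \<open>If \<open>N\<close> lies in \<open>S\<close>, it forms a new pair with each smaller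
  element of \<open>S\<close>; this is Pascal's rule.\<close>

lemma sum_pairs_eq_choose:
  fixes N :: nat
  shows "(\<Sum>j<N. \<Sum>i<j. if i \<in> S \<and> j \<in> S then 1 else 0) = (card (S \<inter> {..<N}) choose 2)"
proof (induction N)
  case (Suc N)
  have "(\<Sum>i<N. if i \<in> S \<and> N \<in> S then 1 else 0) = (if N \<in> S then card (S \<inter> {..<N}) else 0)"
    by (simp add: sum.If_cases Int_def conj_commute)
  moreover have "S \<inter> {..<Suc N} = (if N \<in> S then insert N (S \<inter> {..<N}) else S \<inter> {..<N})"
    by (auto simp: less_Suc_eq)
  ultimately show ?case
    using Suc by (simp add: numeral_2_eq_2)
qed simp

definition vandermonde_power :: "nat \<Rightarrow> nat \<Rightarrow> (nat \<Rightarrow> complex) \<Rightarrow> complex" where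
  "vandermonde_power l N z = (\<Prod>j<N. \<Prod>i<j. (z i - z j) ^ l)"

text \<open>The product over the pairs in \<open>S\<close> is homogeneous of degree \<open>l * (card S choose 2)\<close> in the
  variables with index in \<open>S\<close>.\<close>

lemma vandermonde_power_polys: "vandermonde_power l N \<in> polys N (\<lambda>S. l * (card S choose 2))"
proof -
  have "(\<lambda>z. (z i - z j) ^ l) \<in> polys N (\<lambda>S. l * (if i \<in> S \<and> j \<in> S then 1 else 0))"
    if "j < N" "i < j" for i j
  proof -
    \<comment> \<open>If both indices lie in \<open>S\<close>, each of the two variables has degree
      one in the variables of \<open>S\<close>, and so has every monomial of the difference.\<close>
    have "(\<lambda>z. z i + (-1) * z j) \<in> polys N (\<lambda>S. if i \<in> S \<and> j \<in> S then 1 else 0)"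
      using that by (intro polys_add polys_cmult polys_var) auto
    then show ?thesis
      using polys_power by fastforce
  qed
  then have "(\<lambda>z. \<Prod>j<N. \<Prod>i<j. (z i - z j) ^ l)
      \<in> polys N (\<lambda>S. \<Sum>j<N. \<Sum>i<j. l * (if i \<in> S \<and> j \<in> S then 1 else 0))"
    by (intro polys_prod) auto
  then show ?thesis
    unfolding vandermonde_power_def sum_distrib_left[symmetric] sum_pairs_eq_choose
    by (rule polys_mono) (simp add: Int_absorb2)
qed

section \<open>Gaussian norms of polynomials\<close>

interpretation lborel_product: product_sigma_finite "\<lambda>_ :: nat. lborel :: complex measure"
  by standard

lemma polys_borel_measurable:
  assumes "h \<in> polys N b"
  shows "h \<in> borel_measurable (lborel_CN N)"
  using assms unfolding polys_def by auto

text \<open>Pythagoras for the monomials, which stay orthogonal when every variable has its own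
  Gaussian rate. Separate rates allow the weight of a single particle to be changed.\<close>

lemma nn_integral_poly_gaussian:
  assumes M: "finite M" "M \<subseteq> {m. \<forall>i\<ge>N. m i = 0}" and s: "\<And>i. i < N \<Longrightarrow> s i > 0"
  shows "(\<integral>\<^sup>+z. ennreal ((cmod (\<Sum>m\<in>M. c m * (\<Prod>i<N. z i ^ m i)))\<^sup>2 * (\<Prod>i<N. exp (- s i * (cmod (z i))\<^sup>2)))
      \<partial>lborel_CN N) = ennreal (\<Sum>m\<in>M. (cmod (c m))\<^sup>2 * (\<Prod>i<N. gaussian_moment (m i) (s i)))"
proof -
  define g where "g m m' z = (\<Prod>i<N. z i ^ m i * cnj (z i) ^ m' i * complex_of_real (exp (- s i * (cmod (z i))\<^sup>2)))"
    for m m' :: "nat \<Rightarrow> nat" and z :: "nat \<Rightarrow> complex"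
  have int_g: "integrable (lborel_CN N) (g m m')" for m m'
    unfolding g_def using integrable_gaussian_moment s
    by (intro lborel_product.product_integrable_prod) auto
  have val_g: "(\<integral>z. g m m' z \<partial>lborel_CN N) =
      (if m = m' then of_real (\<Prod>i<N. gaussian_moment (m i) (s i)) else 0)" if "m \<in> M" "m' \<in> M" for m m'
  proof -
    have "(\<integral>z. g m m' z \<partial>lborel_CN N) =
        (\<Prod>i<N. \<integral>w. w ^ m i * cnj w ^ m' i * complex_of_real (exp (- s i * (cmod w)\<^sup>2)) \<partial>lborel)"
      unfolding g_def
      by (rule lborel_product.product_integral_prod) (use s in \<open>simp_all only: integrable_gaussian_moment lessThan_iff finite_lessThan\<close>)
    also have "\<dots> = (\<Prod>i<N. if m i = m' i then of_real (gaussian_moment (m i) (s i)) else 0)"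
      using s by (intro prod.cong refl integral_gaussian_monomials) auto
    finally have "(\<integral>z. g m m' z \<partial>lborel_CN N) =
        (\<Prod>i<N. if m i = m' i then of_real (gaussian_moment (m i) (s i)) else 0)" .
    \<comment> \<open>Both multi-indices vanish from \<open>N\<close> on, so they differ in a
      coordinate that is integrated over, and its factor is zero.\<close>
    moreover have "\<exists>i<N. m i \<noteq> m' i" if "m \<noteq> m'"
    proof -
      obtain i where "m i \<noteq> m' i"
        using \<open>m \<noteq> m'\<close> by blast
      moreover from this have "i < N"
      proof -
        have "m i = 0 \<and> m' i = 0" if "N \<le> i"
          using that M(2) \<open>m \<in> M\<close> \<open>m' \<in> M\<close> by blast
        then show ?thesis
          using \<open>m i \<noteq> m' i\<close> by (cases "i < N") simp_all
      qed
      ultimately show ?thesis by blast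
    qed
    ultimately show ?thesis
      by (cases "m = m'") (auto simp: prod_zero_iff)
  qed
  define f where "f z = (cmod (\<Sum>m\<in>M. c m * (\<Prod>i<N. z i ^ m i)))\<^sup>2 * (\<Prod>i<N. exp (- s i * (cmod (z i))\<^sup>2))"
    for z
  have f: "complex_of_real (f z) = (\<Sum>m\<in>M. \<Sum>m'\<in>M. c m * cnj (c m') * g m m' z)" for z
    unfolding f_def g_def of_real_mult complex_norm_square cnj_sum sum_product
    by (subst sum_distrib_right, intro sum.cong refl, subst sum_distrib_right, intro sum.cong refl)
       (simp add: prod.distrib mult_ac)
  have int_f: "integrable (lborel_CN N) (\<lambda>z. complex_of_real (f z))"
    unfolding f using int_g by (intro Bochner_Integration.integrable_sum integrable_mult_right)
  have "(\<integral>z. complex_of_real (f z) \<partial>lborel_CN N) = (\<Sum>m\<in>M. \<Sum>m'\<in>M. c m * cnj (c m') * (\<integral>z. g m m' z \<partial>lborel_CN N))"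
    unfolding f using int_g by (simp add: Bochner_Integration.integral_sum)
  also have "\<dots> = (\<Sum>m\<in>M. \<Sum>m'\<in>M. if m = m' then
      c m * cnj (c m') * of_real (\<Prod>i<N. gaussian_moment (m i) (s i)) else 0)"
    by (intro sum.cong refl) (simp add: val_g)
  also have "\<dots> = of_real (\<Sum>m\<in>M. (cmod (c m))\<^sup>2 * (\<Prod>i<N. gaussian_moment (m i) (s i)))"
    using M(1) by (simp add: complex_norm_square del: of_real_power)
  finally have "(\<integral>z. f z \<partial>lborel_CN N) = (\<Sum>m\<in>M. (cmod (c m))\<^sup>2 * (\<Prod>i<N. gaussian_moment (m i) (s i)))"
    by (simp only: integral_complex_of_real of_real_eq_iff)
  moreover have "integrable (lborel_CN N) f"
    using int_f by (simp add: complex_of_real_integrable_eq)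
  moreover have "0 \<le> f z" for z
    by (simp add: f_def prod_nonneg)
  ultimately have "(\<integral>\<^sup>+z. ennreal (f z) \<partial>lborel_CN N) =
      ennreal (\<Sum>m\<in>M. (cmod (c m))\<^sup>2 * (\<Prod>i<N. gaussian_moment (m i) (s i)))"
    by (subst nn_integral_eq_integral) auto
  then show ?thesis
    by (simp only: f_def)
qed

text \<open>By orthogonality the comparison is made monomial by monomial: changing the weight of
  particle \<open>k\<close> multiplies the contribution of \<open>m\<close> by
  \<open>x ^ Suc (m k)\<close>, and the sum of these factors over \<open>k\<close> is bounded
  uniformly in \<open>m\<close>.\<close>

lemma polys_gaussian_bound:
  fixes t :: real
  assumes h: "h \<in> polys N (\<lambda>S. l * (card S choose 2))" and t: "0 < t" and l: "1 \<le> l"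
  shows "(\<integral>\<^sup>+z. ennreal ((cmod (h z))\<^sup>2 * exp (- (\<Sum>i<N. (cmod (z i))\<^sup>2))
        * (\<Sum>i<N. exp (- t * (cmod (z i))\<^sup>2))) \<partial>lborel_CN N)
    \<le> ennreal ((1 + real l * t) / (real l * t))
      * (\<integral>\<^sup>+z. ennreal ((cmod (h z))\<^sup>2 * exp (- (\<Sum>i<N. (cmod (z i))\<^sup>2))) \<partial>lborel_CN N)"
proof -
  define x where "x = 1 / (1 + t)"
  have x: "0 < x" "x < 1"
    using t by (auto simp: x_def)
  obtain M c where M: "finite M" "M \<subseteq> staircase N (\<lambda>S. l * (card S choose 2))"
    and h_eq: "h = (\<lambda>z. \<Sum>m\<in>M. c m * (\<Prod>i<N. z i ^ m i))"
    using h unfolding polys_def by blast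
  have h_meas [measurable]: "h \<in> borel_measurable (lborel_CN N)"
    using h by (rule polys_borel_measurable)
  have M0: "M \<subseteq> {m. \<forall>i\<ge>N. m i = 0}"
    using M by (auto simp: staircase_def)
  define P where "P m = (\<Prod>i<N. gaussian_moment (m i) 1)" for m
  have P: "0 \<le> P m" for m
    unfolding P_def by (intro prod_nonneg gaussian_moment_nonneg ballI)
  have weight: "(\<Prod>i<N. exp (- (if i = k then 1 + t else 1) * (cmod (z i))\<^sup>2)) =
      exp (- (\<Sum>i<N. (cmod (z i))\<^sup>2)) * exp (- t * (cmod (z k))\<^sup>2)" if "k < N" for k and z :: "nat \<Rightarrow> complex"
  proof -
    have "(\<Sum>i<N. - (if i = k then 1 + t else 1) * (cmod (z i))\<^sup>2) =
        (\<Sum>i<N. - (cmod (z i))\<^sup>2) + (\<Sum>i<N. if i = k then - t * (cmod (z i))\<^sup>2 else 0)"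
      unfolding sum.distrib[symmetric]
      by (intro sum.cong) (auto simp: algebra_simps)
    also have "\<dots> = - (\<Sum>i<N. (cmod (z i))\<^sup>2) + - t * (cmod (z k))\<^sup>2"
      using that by (simp add: sum_negf)
    finally show ?thesis
      by (simp add: exp_sum[symmetric] exp_add[symmetric])
  qed
  have single: "(\<integral>\<^sup>+z. ennreal ((cmod (h z))\<^sup>2 * exp (- (\<Sum>i<N. (cmod (z i))\<^sup>2)) * exp (- t * (cmod (z k))\<^sup>2)) \<partial>lborel_CN N)
      = ennreal (\<Sum>m\<in>M. (cmod (c m))\<^sup>2 * (P m * x ^ Suc (m k)))" if k: "k < N" for k
  proof -
    have "(\<Prod>i<N. gaussian_moment (m i) (if i = k then 1 + t else 1)) = P m * x ^ Suc (m k)" for m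
    proof -
      have "(\<Prod>i<N. gaussian_moment (m i) (if i = k then 1 + t else 1)) =
          (\<Prod>i<N. gaussian_moment (m i) 1 * (if i = k then x ^ Suc (m i) else 1))"
        using t gaussian_moment_scale[of "1 + t"] by (intro prod.cong) (auto simp: x_def)
      then show ?thesis
        using k by (simp add: prod.distrib P_def)
    qed
    moreover have "(cmod (h z))\<^sup>2 * exp (- (\<Sum>i<N. (cmod (z i))\<^sup>2)) * exp (- t * (cmod (z k))\<^sup>2)
        = (cmod (\<Sum>m\<in>M. c m * (\<Prod>i<N. z i ^ m i)))\<^sup>2 * (\<Prod>i<N. exp (- (if i = k then 1 + t else 1) * (cmod (z i))\<^sup>2))" for z
      by (simp only: weight[OF k] h_eq mult.assoc)
    moreover have "0 < (if i = k then 1 + t else 1)" for i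
      using t by simp
    ultimately show ?thesis
      using nn_integral_poly_gaussian[where M = M and N = N and c = c and s = "\<lambda>i. if i = k then 1 + t else 1", OF M(1) M0]
      by (simp only:)
  qed
  have combin: "(\<Sum>k<N. x ^ Suc (m k)) \<le> (1 + real l * t) / (real l * t)" if "m \<in> M" for m
  proof -
    have "l * (card S choose 2) \<le> sum m S" if "S \<subseteq> {..<N}" for S
      using that \<open>m \<in> M\<close> M(2) unfolding staircase_def by blast
    then have "(\<Sum>k<N. x ^ m k) \<le> (\<Sum>j<card {..<N}. x ^ (l * j))"
      using sum_power_le_of_subset_sums[of "{..<N}" l m x] x by blast
    then have "x * (\<Sum>k<N. x ^ m k) \<le> x * (\<Sum>j<N. x ^ (l * j))"
      using x by simp
    also have "\<dots> \<le> (1 + real l * t) / (real l * t)"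
      unfolding x_def using t l by (rule inverse_power_geometric_le)
    finally show ?thesis by (simp add: sum_distrib_left)
  qed
  have "(\<integral>\<^sup>+z. ennreal ((cmod (h z))\<^sup>2 * exp (- (\<Sum>i<N. (cmod (z i))\<^sup>2))
        * (\<Sum>i<N. exp (- t * (cmod (z i))\<^sup>2))) \<partial>lborel_CN N)
      = (\<integral>\<^sup>+z. (\<Sum>k<N. ennreal ((cmod (h z))\<^sup>2 * exp (- (\<Sum>i<N. (cmod (z i))\<^sup>2)) * exp (- t * (cmod (z k))\<^sup>2))) \<partial>lborel_CN N)"
    by (simp add: sum_distrib_left)
  also have "\<dots> = (\<Sum>k<N. ennreal (\<Sum>m\<in>M. (cmod (c m))\<^sup>2 * (P m * x ^ Suc (m k))))"
    using single by (subst nn_integral_sum) auto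
  also have "\<dots> = ennreal (\<Sum>k<N. \<Sum>m\<in>M. (cmod (c m))\<^sup>2 * (P m * x ^ Suc (m k)))"
    using x P by (intro sum_ennreal sum_nonneg) auto
  also have "(\<Sum>k<N. \<Sum>m\<in>M. (cmod (c m))\<^sup>2 * (P m * x ^ Suc (m k)))
      = (\<Sum>m\<in>M. (cmod (c m))\<^sup>2 * P m * (\<Sum>k<N. x ^ Suc (m k)))"
    by (subst sum.swap) (simp add: sum_distrib_left mult_ac)
  also have "ennreal \<dots> \<le> ennreal (\<Sum>m\<in>M. (cmod (c m))\<^sup>2 * P m * ((1 + real l * t) / (real l * t)))"
    using combin P by (intro ennreal_leI sum_mono mult_left_mono) auto
  also have "\<dots> = ennreal ((1 + real l * t) / (real l * t)) * ennreal (\<Sum>m\<in>M. (cmod (c m))\<^sup>2 * P m)"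
    unfolding sum_distrib_right[symmetric] using t P
    by (subst ennreal_mult[symmetric]) (auto intro!: sum_nonneg divide_nonneg_nonneg add_nonneg_nonneg simp: mult.commute)
  also have "ennreal (\<Sum>m\<in>M. (cmod (c m))\<^sup>2 * P m) =
      (\<integral>\<^sup>+z. ennreal ((cmod (h z))\<^sup>2 * exp (- (\<Sum>i<N. (cmod (z i))\<^sup>2))) \<partial>lborel_CN N)"
  proof -
    have "(\<Prod>i<N. exp (- 1 * (cmod (z i))\<^sup>2)) = exp (- (\<Sum>i<N. (cmod (z i))\<^sup>2))" for z :: "nat \<Rightarrow> complex"
    proof -
      have "(\<Prod>i<N. exp (- 1 * (cmod (z i))\<^sup>2)) = exp (\<Sum>i<N. - 1 * (cmod (z i))\<^sup>2)"
        by (rule exp_sum[symmetric]) simp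
      then show ?thesis by (simp add: sum_negf)
    qed
    then show ?thesis
      using nn_integral_poly_gaussian[where M = M and N = N and c = c and s = "\<lambda>_. 1", OF M(1) M0]
      by (simp only: P_def h_eq zero_less_one)
  qed
  finally show ?thesis .
qed

section \<open>Homogeneous expansions of entire functions\<close>

lemma sum_power_root_unity:
  fixes d d' q :: nat
  assumes "d < q" "d' < q"
  defines "w \<equiv> cis (2 * pi / real q)"
  shows "(\<Sum>j<q. (w ^ j) ^ d * cnj ((w ^ j) ^ d')) = (if d = d' then of_nat q else 0)"
proof -
  define \<zeta> where "\<zeta> = cis ((real d - real d') / real q * (2 * pi))"
  have zeta_power: "(w ^ j) ^ d * cnj ((w ^ j) ^ d') = \<zeta> ^ j" for j
  proof -
    have "(w ^ j) ^ d * cnj ((w ^ j) ^ d') = (w ^ d * cnj w ^ d') ^ j"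
      by (simp add: power_mult_distrib power_mult[symmetric] mult.commute)
    also have "w ^ d * cnj w ^ d' = \<zeta>"
      unfolding w_def \<zeta>_def cis_cnj Complex.DeMoivre cis_mult by (simp add: field_simps diff_divide_distrib)
    finally show ?thesis .
  qed
  show ?thesis
  proof (cases "d = d'")
    case True
    then show ?thesis
      unfolding zeta_power by (simp add: \<zeta>_def)
  next
    case False
    \<comment> \<open>As \<open>d\<close> and \<open>d'\<close> differ by less than
      \<open>q\<close>, the angle is no multiple of a full turn. The geometric sum of a
      \<open>q\<close>-th root of unity other than 1 is zero.\<close>
    have "\<zeta> \<noteq> 1"
    proof
      assume "\<zeta> = 1"
      then obtain n where "(real d - real d') / real q * (2 * pi) = of_int n * (2 * pi)"
        unfolding \<zeta>_def cis_eq_1_iff by blast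
      then have n: "(real d - real d') / real q = of_int n"
        by (simp only: mult_cancel_right) simp
      have "\<bar>real d - real d'\<bar> < real q"
        using assms(1,2) by linarith
      then have "\<bar>(real d - real d') / real q\<bar> < 1"
        by (simp add: abs_divide)
      then have "n = 0"
        unfolding n by linarith
      then show False
        using n False assms(1) by simp
    qed
    moreover have "\<zeta> ^ q = 1"
    proof -
      have "\<zeta> ^ q = cis (of_int (int d - int d') * (2 * pi))"
        unfolding \<zeta>_def Complex.DeMoivre using assms by simp
      then show ?thesis
        by (simp only: cis_eq_1_iff) blast
    qed
    ultimately show ?thesis
      unfolding zeta_power using False by (simp add: sum_gp_strict)
  qed
qed

text \<open>With \<open>n \<le> q\<close> no two exponents are congruent modulo \<open>q\<close>, so
  the \<open>q\<close>-th roots of unity separate them.\<close>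

lemma parseval_roots_unity:
  fixes c :: "nat \<Rightarrow> complex"
  assumes "n \<le> q"
  defines "w \<equiv> cis (2 * pi / real q)"
  shows "(\<Sum>j<q. (cmod (\<Sum>d<n. c d * (w ^ j) ^ d))\<^sup>2) = real q * (\<Sum>d<n. (cmod (c d))\<^sup>2)"
proof -
  have "complex_of_real (\<Sum>j<q. (cmod (\<Sum>d<n. c d * (w ^ j) ^ d))\<^sup>2) =
      (\<Sum>j<q. \<Sum>d<n. \<Sum>d'<n. c d * cnj (c d') * ((w ^ j) ^ d * cnj ((w ^ j) ^ d')))"
    unfolding of_real_sum complex_norm_square cnj_sum sum_product
    by (intro sum.cong refl) (simp add: mult_ac)
  also have "\<dots> = (\<Sum>d<n. \<Sum>d'<n. c d * cnj (c d') * (\<Sum>j<q. (w ^ j) ^ d * cnj ((w ^ j) ^ d')))"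
    unfolding sum_distrib_left by (rule trans[OF sum.swap], rule sum.cong[OF refl], rule sum.swap)
  also have "\<dots> = (\<Sum>d<n. \<Sum>d'<n. if d = d' then c d * cnj (c d') * of_nat q else 0)"
    using assms(1) unfolding w_def by (intro sum.cong refl, subst sum_power_root_unity) auto
  also have "\<dots> = complex_of_real (real q * (\<Sum>d<n. (cmod (c d))\<^sup>2))"
    by (simp add: complex_norm_square sum_distrib_left mult.commute del: of_real_power)
  finally show ?thesis
    by (simp only: of_real_eq_iff)
qed

text \<open>Bessel's inequality on the circle, with finite averages in place of the integral.
  Parseval is exact for the series truncated at \<open>q\<close>, and the truncation costs at most
  \<open>2 * C * \<tau> q\<close>, which tends to zero.\<close>

lemma bessel_roots_unity:
  fixes c :: "nat \<Rightarrow> complex"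
  assumes c: "summable (\<lambda>d. cmod (c d))"
  shows "ennreal (\<Sum>d<n. (cmod (c d))\<^sup>2) \<le>
    liminf (\<lambda>q. ennreal ((\<Sum>j<q. (cmod (\<Sum>d. c d * (cis (2 * pi / real q) ^ j) ^ d))\<^sup>2) / real q))"
proof -
  define C where "C = (\<Sum>d. cmod (c d))"
  define \<tau> where "\<tau> q = (\<Sum>d. cmod (c (d + q)))" for q
  define X where "X = (\<Sum>d<n. (cmod (c d))\<^sup>2)"
  have \<tau>: "\<tau> \<longlonglongrightarrow> 0"
    unfolding \<tau>_def using suminf_exist_split2[OF c] .
  have main: "X - 2 * C * \<tau> q \<le> (\<Sum>j<q. (cmod (\<Sum>d. c d * (cis (2 * pi / real q) ^ j) ^ d))\<^sup>2) / real q"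
    if q: "n \<le> q" "0 < q" for q
  proof -
    define w where "w = cis (2 * pi / real q)"
    have w: "cmod w = 1" by (simp add: w_def)
    have "(cmod (\<Sum>d<q. c d * (w ^ j) ^ d))\<^sup>2 - 2 * C * \<tau> q \<le> (cmod (\<Sum>d. c d * (w ^ j) ^ d))\<^sup>2" for j
    proof -
      define u where "u = (\<Sum>d. c d * (w ^ j) ^ d)"
      define v where "v = (\<Sum>d<q. c d * (w ^ j) ^ d)"
      have nrm: "cmod (c d * (w ^ j) ^ d) = cmod (c d)" for d
        by (simp add: norm_mult norm_power w)
      then have s: "summable (\<lambda>d. cmod (c d * (w ^ j) ^ d))"
        using c by simp
      have "u = (\<Sum>d. c (d + q) * (w ^ j) ^ (d + q)) + v"
        unfolding u_def v_def using summable_norm_cancel[OF s] by (rule suminf_split_initial_segment)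
      then have "cmod (u - v) \<le> (\<Sum>d. cmod (c (d + q) * (w ^ j) ^ (d + q)))"
        using summable_norm[OF summable_ignore_initial_segment[OF s, of q]] by simp
      then have uv: "cmod (v - u) \<le> \<tau> q"
        by (simp add: nrm \<tau>_def norm_minus_commute)
      have "cmod v \<le> (\<Sum>d<q. cmod (c d))"
        unfolding v_def by (rule order_trans[OF norm_sum]) (simp add: nrm)
      also have "\<dots> \<le> C"
        unfolding C_def using c by (intro sum_le_suminf) auto
      finally have v: "cmod v \<le> C" .
      \<comment> \<open>The inequality \<open>cmod v - \<tau> q \<le> cmod u\<close> can be squared
        only if its left side is nonnegative. Otherwise
        \<open>(cmod v)\<^sup>2 - 2 * cmod v * \<tau> q\<close> is at most zero anyway.\<close>
      have "(cmod v - \<tau> q)\<^sup>2 \<le> (cmod u)\<^sup>2 \<or> cmod v < \<tau> q"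
      proof (cases "cmod v < \<tau> q")
        case False
        have "cmod v - \<tau> q \<le> cmod u"
          using uv norm_triangle_ineq2[of v u] by linarith
        then show ?thesis
          using False by (intro disjI1 power_mono) simp_all
      qed simp
      then have "(cmod v)\<^sup>2 - 2 * cmod v * \<tau> q \<le> (cmod u)\<^sup>2"
      proof
        assume "(cmod v - \<tau> q)\<^sup>2 \<le> (cmod u)\<^sup>2"
        then show ?thesis
          using zero_le_power2[of "\<tau> q"] unfolding power2_diff by linarith
      next
        assume "cmod v < \<tau> q"
        then have "cmod v * cmod v \<le> cmod v * \<tau> q"
          by (intro mult_left_mono) auto
        moreover have "0 \<le> cmod v * cmod v" "0 \<le> (cmod u)\<^sup>2"
          by simp_all
        ultimately show ?thesis
          unfolding power2_eq_square[of "cmod v"] mult.assoc by linarith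
      qed
      moreover have "cmod v * \<tau> q \<le> C * \<tau> q"
        using v order_trans[OF norm_ge_zero uv] by (rule mult_right_mono)
      ultimately show ?thesis
        unfolding u_def v_def by simp
    qed
    then have "(\<Sum>j<q. (cmod (\<Sum>d<q. c d * (w ^ j) ^ d))\<^sup>2 - 2 * C * \<tau> q) \<le> (\<Sum>j<q. (cmod (\<Sum>d. c d * (w ^ j) ^ d))\<^sup>2)"
      by (intro sum_mono)
    moreover have "(\<Sum>j<q. (cmod (\<Sum>d<q. c d * (w ^ j) ^ d))\<^sup>2) = real q * (\<Sum>d<q. (cmod (c d))\<^sup>2)"
      unfolding w_def by (rule parseval_roots_unity) simp
    moreover have "X \<le> (\<Sum>d<q. (cmod (c d))\<^sup>2)"
      unfolding X_def using q by (intro sum_mono2) auto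
    ultimately have "real q * X - real q * (2 * C * \<tau> q) \<le> (\<Sum>j<q. (cmod (\<Sum>d. c d * (w ^ j) ^ d))\<^sup>2)"
      using mult_left_mono[of X "\<Sum>d<q. (cmod (c d))\<^sup>2" "real q"] by (simp add: sum_subtractf)
    then show ?thesis
      using q by (simp add: w_def field_simps)
  qed
  have "(\<lambda>q. X - 2 * C * \<tau> q) \<longlonglongrightarrow> X - 2 * C * 0"
    by (intro tendsto_intros \<tau>)
  then have "(\<lambda>q. ennreal (X - 2 * C * \<tau> q)) \<longlonglongrightarrow> ennreal X"
    by (intro tendsto_ennrealI) simp
  then have "ennreal X = liminf (\<lambda>q. ennreal (X - 2 * C * \<tau> q))"
    using lim_imp_Liminf[OF sequentially_bot] by metis
  also have "\<dots> \<le> liminf (\<lambda>q. ennreal ((\<Sum>j<q. (cmod (\<Sum>d. c d * (cis (2 * pi / real q) ^ j) ^ d))\<^sup>2) / real q))"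
    using main by (intro Liminf_mono eventually_sequentiallyI[of "Suc n"] ennreal_leI) auto
  finally show ?thesis
    unfolding X_def .
qed

section \<open>Series of homogeneous polynomials\<close>

text \<open>By homogeneity a common rotation of all variables multiplies \<open>k d\<close> by a
  \<open>d\<close>-th power, so the degree acts as a Fourier index. Convergence is required at every
  point and not only near the origin.\<close>

definition homogeneous_expansion ::
    "nat \<Rightarrow> (nat \<Rightarrow> (nat \<Rightarrow> complex) \<Rightarrow> complex) \<Rightarrow> ((nat \<Rightarrow> complex) \<Rightarrow> complex) \<Rightarrow> bool" where
  "homogeneous_expansion N k G \<longleftrightarrow> (\<forall>d. k d \<in> polys N (\<lambda>_. 0)) \<and>
     (\<forall>d t z. k d (\<lambda>i. t * z i) = t ^ d * k d z) \<and> (\<forall>z. (\<lambda>d. k d z) sums G z)"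

text \<open>Convergence at \<open>2 * z\<close> gives absolute convergence at \<open>z\<close>, as
  for a power series in one variable inside its disk.\<close>

lemma homogeneous_expansion_summable:
  assumes "homogeneous_expansion N k G"
  shows "summable (\<lambda>d. cmod (k d z))"
proof -
  have "summable (\<lambda>d. k d (\<lambda>i. 2 * z i))"
    using assms sums_summable unfolding homogeneous_expansion_def by blast
  moreover have "k d (\<lambda>i. 2 * z i) = k d z * 2 ^ d" for d
    using assms unfolding homogeneous_expansion_def by (metis mult.commute)
  ultimately have "summable (\<lambda>d. k d z * 2 ^ d)"
    by (simp only:)
  from powser_insidea[OF this, of 1] show ?thesis
    by simp
qed

text \<open>A magnetic translation by \<open>a\<close> contributes this factor with
  \<open>\<beta> = - cnj a\<close>.\<close>

lemma homogeneous_expansion_linear_exp: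
  "homogeneous_expansion N (\<lambda>d z. (\<beta> * (\<Sum>i<N. z i)) ^ d /\<^sub>R fact d) (\<lambda>z. exp (\<beta> * (\<Sum>i<N. z i)))"
  unfolding homogeneous_expansion_def
proof (intro conjI allI)
  fix d
  have "(\<lambda>z. \<beta> * (\<Sum>i<N. z i)) \<in> polys N (\<lambda>_. 0)"
    by (intro polys_cmult polys_sum polys_var) auto
  then have "(\<lambda>z. of_real (inverse (fact d)) * (\<beta> * (\<Sum>i<N. z i)) ^ d) \<in> polys N (\<lambda>_. 0)"
    using polys_power[of "\<lambda>z. \<beta> * (\<Sum>i<N. z i)" N "\<lambda>_. 0" d] by (intro polys_cmult) simp
  then show "(\<lambda>z. (\<beta> * (\<Sum>i<N. z i)) ^ d /\<^sub>R fact d) \<in> polys N (\<lambda>_. 0)"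
    by (simp add: scaleR_conv_of_real)
next
  fix d t and z :: "nat \<Rightarrow> complex"
  show "(\<beta> * (\<Sum>i<N. t * z i)) ^ d /\<^sub>R fact d = t ^ d * ((\<beta> * (\<Sum>i<N. z i)) ^ d /\<^sub>R fact d)"
    by (simp add: sum_distrib_left[symmetric] power_mult_distrib mult_ac)
next
  fix z :: "nat \<Rightarrow> complex"
  show "(\<lambda>d. (\<beta> * (\<Sum>i<N. z i)) ^ d /\<^sub>R fact d) sums exp (\<beta> * (\<Sum>i<N. z i))"
    by (rule exp_converges)
qed

text \<open>Absolute convergence justifies the Cauchy product, whose \<open>d\<close>-th term
  collects the pairs of degrees \<open>i\<close> and \<open>d - i\<close>.\<close>

lemma homogeneous_expansion_mult:
  assumes G: "homogeneous_expansion N k G" and H: "homogeneous_expansion N k' H"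
  shows "homogeneous_expansion N (\<lambda>d z. \<Sum>i\<le>d. k i z * k' (d - i) z) (\<lambda>z. G z * H z)"
  unfolding homogeneous_expansion_def
proof (intro conjI allI)
  fix d
  show "(\<lambda>z. \<Sum>i\<le>d. k i z * k' (d - i) z) \<in> polys N (\<lambda>_. 0)"
    using G H polys_mult[of _ N "\<lambda>_. 0" _ "\<lambda>_. 0"] unfolding homogeneous_expansion_def
    by (intro polys_sum) auto
next
  fix d t and z :: "nat \<Rightarrow> complex"
  have "k i (\<lambda>i. t * z i) * k' (d - i) (\<lambda>i. t * z i) = t ^ d * (k i z * k' (d - i) z)" if "i \<le> d" for i
  proof -
    have "k i (\<lambda>i. t * z i) * k' (d - i) (\<lambda>i. t * z i) = (t ^ i * t ^ (d - i)) * (k i z * k' (d - i) z)"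
      using G H by (simp add: homogeneous_expansion_def mult_ac)
    then show ?thesis
      using that by (simp add: power_add[symmetric])
  qed
  then show "(\<Sum>i\<le>d. k i (\<lambda>i. t * z i) * k' (d - i) (\<lambda>i. t * z i)) = t ^ d * (\<Sum>i\<le>d. k i z * k' (d - i) z)"
    by (simp add: sum_distrib_left)
next
  fix z
  have "(\<Sum>d. k d z) = G z" "(\<Sum>d. k' d z) = H z"
    using G H sums_unique unfolding homogeneous_expansion_def by metis+
  then show "(\<lambda>d. \<Sum>i\<le>d. k i z * k' (d - i) z) sums (G z * H z)"
    using Cauchy_product_sums[OF homogeneous_expansion_summable[OF G] homogeneous_expansion_summable[OF H], of z z]
    by simp
qed

text \<open>Unordered summability allows the multi-indices to be grouped by total degree. Each group
  is finite and, on the line through \<open>w\<close> in direction \<open>z\<close>, contributes a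
  single power of \<open>u\<close>.\<close>

lemma local_power_series_along_line:
  assumes a: "\<forall>z\<in>CN N. (\<forall>i<N. cmod (z i - w i) < r) \<longrightarrow>
      ((\<lambda>m. a m * (\<Prod>i<N. (z i - w i) ^ m i)) has_sum F z) ({..<N} \<rightarrow>\<^sub>E UNIV)"
    and u: "\<And>i. i < N \<Longrightarrow> cmod (u * z i) < r"
  shows "(\<lambda>d. (\<Sum>m | m \<in> {..<N} \<rightarrow>\<^sub>E UNIV \<and> sum m {..<N} = d. a m * (\<Prod>i<N. z i ^ m i)) * u ^ d)
      sums F (\<lambda>i\<in>{..<N}. w i + u * z i)"
proof -
  define E where "E d = {m. m \<in> {..<N} \<rightarrow>\<^sub>E (UNIV :: nat set) \<and> sum m {..<N} = d}" for d
  define f where "f = (\<lambda>(d, m). a m * (\<Prod>i<N. z i ^ m i) * u ^ d)"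
  have fin: "finite (E d)" for d
  proof (rule finite_subset)
    have "m i \<le> d" if "m \<in> E d" "i < N" for m i
      using that member_le_sum[of i "{..<N}" m] by (auto simp: E_def)
    moreover have "E d \<subseteq> {..<N} \<rightarrow>\<^sub>E UNIV"
      by (auto simp: E_def)
    ultimately show "E d \<subseteq> {..<N} \<rightarrow>\<^sub>E {..d}"
      unfolding PiE_iff subset_iff by simp
  qed (intro finite_PiE; simp)
  have "((\<lambda>m. a m * (\<Prod>i<N. (u * z i) ^ m i)) has_sum F (\<lambda>i\<in>{..<N}. w i + u * z i)) ({..<N} \<rightarrow>\<^sub>E UNIV)"
  proof -
    have "(\<lambda>i\<in>{..<N}. w i + u * z i) \<in> CN N"
      by (simp add: PiE_iff)
    then have "((\<lambda>m. a m * (\<Prod>i<N. ((\<lambda>i\<in>{..<N}. w i + u * z i) i - w i) ^ m i))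
        has_sum F (\<lambda>i\<in>{..<N}. w i + u * z i)) ({..<N} \<rightarrow>\<^sub>E UNIV)"
      using u by (intro a[rule_format]) (assumption, simp)
    then show ?thesis by simp
  qed
  moreover have "((\<lambda>m. a m * (\<Prod>i<N. (u * z i) ^ m i)) has_sum F (\<lambda>i\<in>{..<N}. w i + u * z i)) ({..<N} \<rightarrow>\<^sub>E UNIV)
      \<longleftrightarrow> (f has_sum F (\<lambda>i\<in>{..<N}. w i + u * z i)) (Sigma UNIV E)"
    by (rule has_sum_reindex_bij_witness[of _ snd "\<lambda>m. (sum m {..<N}, m)"])
       (auto simp: E_def f_def power_mult_distrib prod.distrib power_sum mult_ac)
  ultimately have "(f has_sum F (\<lambda>i\<in>{..<N}. w i + u * z i)) (Sigma UNIV E)"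
    by blast
  then have "((\<lambda>d. \<Sum>m\<in>E d. f (d, m)) has_sum F (\<lambda>i\<in>{..<N}. w i + u * z i)) UNIV"
    by (rule has_sum_SigmaD) (use fin in auto)
  then show ?thesis
    using has_sum_imp_sums by (force simp: f_def E_def sum_distrib_right)
qed

text \<open>The series at the base point is only known to converge nearby. On each complex line
  through that point \<open>F\<close> is an entire function of one variable, so its Taylor series
  converges everywhere, and the coefficients are read off from the local series.\<close>

lemma analytic_CN_homogeneous_expansion:
  assumes F: "analytic_CN N F"
  obtains k where "homogeneous_expansion N k (\<lambda>z. F (\<lambda>i\<in>{..<N}. w i + z i))"
proof -
  define c where "c = (\<lambda>i\<in>{..<N}. w i)"
  have "c \<in> CN N" by (auto simp: c_def)
  then obtain a r where r: "r > 0" and a: "\<forall>z\<in>CN N. (\<forall>i<N. cmod (z i - c i) < r) \<longrightarrow>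
      ((\<lambda>m. a m * (\<Prod>i<N. (z i - c i) ^ m i)) has_sum F z) ({..<N} \<rightarrow>\<^sub>E UNIV)"
    using F unfolding analytic_CN_def by blast
  define E where "E d = {m. m \<in> {..<N} \<rightarrow>\<^sub>E (UNIV :: nat set) \<and> sum m {..<N} = d}" for d
  define k where "k d z = (\<Sum>m\<in>E d. a m * (\<Prod>i<N. z i ^ m i))" for d z
  have "homogeneous_expansion N k (\<lambda>z. F (\<lambda>i\<in>{..<N}. w i + z i))"
    unfolding homogeneous_expansion_def
  proof (intro conjI allI)
    fix d
    have "(\<lambda>z. a m * (\<Prod>i<N. z i ^ m i)) \<in> polys N (\<lambda>_. 0)" for m
    proof -
      have "(\<lambda>z. a m * (\<Prod>i<N. z i ^ (if i < N then m i else 0))) \<in> polys N (\<lambda>_. 0)"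
        by (rule polys_monomial) (auto simp: staircase_def)
      then show ?thesis by simp
    qed
    then show "k d \<in> polys N (\<lambda>_. 0)"
      unfolding k_def by (intro polys_sum)
  next
    fix d t and z :: "nat \<Rightarrow> complex"
    show "k d (\<lambda>i. t * z i) = t ^ d * k d z"
      unfolding k_def sum_distrib_left
      by (intro sum.cong refl) (auto simp: E_def power_mult_distrib prod.distrib power_sum)
  next
    fix z :: "nat \<Rightarrow> complex"
    \<comment> \<open>\<open>B\<close> strictly exceeds every \<open>cmod (z i)\<close>, so a
      parameter smaller than \<open>s / B\<close> moves each coordinate by less than
      \<open>s\<close>. The summand 1 keeps \<open>B\<close> positive.\<close>
    define B where "B = 1 + (\<Sum>i<N. cmod (z i))"
    have B: "0 < B" "cmod (z i) < B" if "i < N" for i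
      using that member_le_sum[of i "{..<N}" "\<lambda>i. cmod (z i)"]
      by (auto simp: B_def intro!: add_pos_nonneg sum_nonneg)
    have B0: "0 < B"
      by (auto simp: B_def intro!: add_pos_nonneg sum_nonneg)
    have small: "cmod (u * z i) < s" if "cmod u < s / B" "i < N" for u s i
    proof -
      have "cmod (u * z i) \<le> cmod u * B"
        using B[OF that(2)] by (auto simp: norm_mult intro!: mult_left_mono)
      also have "\<dots> < s"
        using that B0 by (simp add: field_simps)
      finally show ?thesis .
    qed
    define g where "g t = F (\<lambda>i\<in>{..<N}. w i + t * z i)" for t
    have "g field_differentiable at t" for t
    proof -
      define c' where "c' = (\<lambda>i\<in>{..<N}. w i + t * z i)"
      have "c' \<in> CN N" by (auto simp: c'_def)
      then obtain a' r' where r': "r' > 0" and a': "\<forall>z\<in>CN N. (\<forall>i<N. cmod (z i - c' i) < r') \<longrightarrow>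
          ((\<lambda>m. a' m * (\<Prod>i<N. (z i - c' i) ^ m i)) has_sum F z) ({..<N} \<rightarrow>\<^sub>E UNIV)"
        using F unfolding analytic_CN_def by blast
      have "(\<lambda>d. (\<Sum>m | m \<in> {..<N} \<rightarrow>\<^sub>E UNIV \<and> sum m {..<N} = d. a' m * (\<Prod>i<N. z i ^ m i)) * (s - t) ^ d)
          sums g s" if "s \<in> ball t (r' / B)" for s
      proof -
        have "cmod (s - t) < r' / B"
          using that by (simp add: dist_norm norm_minus_commute)
        moreover have "(\<lambda>i\<in>{..<N}. c' i + (s - t) * z i) = (\<lambda>i\<in>{..<N}. w i + s * z i)"
          by (auto simp: c'_def fun_eq_iff algebra_simps)
        ultimately show ?thesis
          using local_power_series_along_line[OF a', of "s - t" z] small unfolding g_def by simp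
      qed
      then have "g holomorphic_on ball t (r' / B)"
        by (rule power_series_holomorphic)
      then show ?thesis
        using r' B0 by (simp add: holomorphic_on_imp_differentiable_at)
    qed
    \<comment> \<open>Radius 2 puts the parameter 1, at which the series is evaluated, inside the
      disk.\<close>
    then have hol: "g holomorphic_on ball 0 2"
      by (simp add: holomorphic_on_def field_differentiable_at_within)
    have near0: "(\<lambda>d. k d z * u ^ d) sums g u" if "cmod u < r / B" for u
    proof -
      have "(\<lambda>i\<in>{..<N}. c i + u * z i) = (\<lambda>i\<in>{..<N}. w i + u * z i)"
        by (auto simp: c_def)
      then show ?thesis
        using local_power_series_along_line[OF a, of u z] small[OF that] unfolding g_def k_def E_def by simp
    qed
    have "eventually (\<lambda>u. cmod u < r / B) (nhds 0)"
      using eventually_nhds_in_open[of "ball 0 (r / B)" "0 :: complex"] r B0 by simp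
    then have "g has_fps_expansion Abs_fps (\<lambda>d. k d z)"
      using near0 by (intro has_fps_expansionI) (auto elim: eventually_mono)
    then have "k d z = (deriv ^^ d) g 0 / fact d" for d
      using fps_nth_fps_expansion by fastforce
    then show "(\<lambda>d. k d z) sums F (\<lambda>i\<in>{..<N}. w i + z i)"
      using holomorphic_power_series[OF hol, of 1] by (simp add: g_def)
  qed
  then show thesis ..
qed

section \<open>Passage from polynomials to entire functions\<close>

lemma polys_restrict: "h \<in> polys N b \<Longrightarrow> h (\<lambda>i\<in>{..<N}. z i) = h z"
  unfolding polys_def by auto

lemma homogeneous_expansion_measurable:
  assumes "homogeneous_expansion N k G"
  shows "G \<in> borel_measurable (lborel_CN N)"
proof (rule borel_measurable_LIMSEQ_metric)
  show "(\<lambda>z. \<Sum>d<n. k d z) \<in> borel_measurable (lborel_CN N)" for n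
    using assms polys_borel_measurable unfolding homogeneous_expansion_def
    by (intro borel_measurable_sum) blast
  show "(\<lambda>n. \<Sum>d<n. k d z) \<longlonglongrightarrow> G z" for z
    using assms unfolding homogeneous_expansion_def sums_def by blast
qed

lemma cmod_vandermonde_power_rotate:
  assumes "cmod w = 1"
  shows "cmod (vandermonde_power l N (\<lambda>i. w * z i)) = cmod (vandermonde_power l N z)"
  using assms
  by (simp add: vandermonde_power_def prod_norm[symmetric] norm_power norm_mult right_diff_distrib[symmetric])

text \<open>Lebesgue measure and \<open>\<phi>\<close> are invariant under common rotations, so all
  \<open>q\<close> terms have the same integral.\<close>

lemma nn_integral_rotation_average:
  fixes a \<phi> :: "(nat \<Rightarrow> complex) \<Rightarrow> real"
  assumes [measurable]: "a \<in> borel_measurable (lborel_CN N)" "\<phi> \<in> borel_measurable (lborel_CN N)"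
    and nonneg: "\<And>z. 0 \<le> a z" "\<And>z. 0 \<le> \<phi> z"
    and inv: "\<And>w z. cmod w = 1 \<Longrightarrow> \<phi> (\<lambda>i\<in>{..<N}. w * z i) = \<phi> z"
    and q: "0 < q"
  shows "(\<integral>\<^sup>+z. ennreal ((\<Sum>j<q. a (\<lambda>i\<in>{..<N}. cis (2 * pi / real q) ^ j * z i)) / real q * \<phi> z) \<partial>lborel_CN N)
    = (\<integral>\<^sup>+z. ennreal (a z * \<phi> z) \<partial>lborel_CN N)"
proof -
  define f where "f z = ennreal (a z * \<phi> z)" for z
  have [measurable]: "f \<in> borel_measurable (lborel_CN N)"
    unfolding f_def by measurable
  define T where "T j z = (\<lambda>i\<in>{..<N}. cis (2 * pi / real q) ^ j * z i)" for j and z :: "nat \<Rightarrow> complex"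
  have [measurable]: "T j \<in> lborel_CN N \<rightarrow>\<^sub>M lborel_CN N" for j
    unfolding T_def by measurable
  have nrm: "cmod (cis (2 * pi / real q) ^ j) = 1" for j
    by (simp add: norm_power)
  have rot: "(\<integral>\<^sup>+z. f (T j z) \<partial>lborel_CN N) = (\<integral>\<^sup>+z. f z \<partial>lborel_CN N)" for j
    unfolding T_def
    by (rule nn_integral_PiM_componentwise) (auto simp: distr_lborel_rotate nrm lborel.sigma_finite_measure_axioms)
  have "ennreal ((\<Sum>j<q. a (T j z)) / real q * \<phi> z) = ennreal (1 / real q) * (\<Sum>j<q. f (T j z))" for z
  proof -
    have "(\<Sum>j<q. f (T j z)) = ennreal (\<Sum>j<q. a (T j z) * \<phi> z)"
      using nonneg inv[OF nrm] by (simp add: f_def T_def)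
    then show ?thesis
      using nonneg by (simp add: ennreal_mult[symmetric] sum_nonneg sum_distrib_right[symmetric])
  qed
  then have "(\<integral>\<^sup>+z. ennreal ((\<Sum>j<q. a (T j z)) / real q * \<phi> z) \<partial>lborel_CN N)
      = ennreal (1 / real q) * (\<Sum>j<q. \<integral>\<^sup>+z. f (T j z) \<partial>lborel_CN N)"
    by (simp add: nn_integral_cmult nn_integral_sum)
  also have "\<dots> = (ennreal (1 / real q) * of_nat q) * (\<integral>\<^sup>+z. f z \<partial>lborel_CN N)"
    by (simp add: rot mult.assoc)
  also have "ennreal (1 / real q) * of_nat q = 1"
    using q by (simp add: ennreal_of_nat_eq_real_of_nat ennreal_mult[symmetric])
  finally show ?thesis
    unfolding f_def T_def mult_1 .
qed

text \<open>For a rotation invariant weight, parts of different degree are orthogonal, so truncating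
  the degree does not increase the norm. The orthogonality is applied pointwise, by averages over
  roots of unity, so an infinite right-hand side is included.\<close>

lemma nn_integral_partial_sum_le:
  assumes k: "homogeneous_expansion N k G"
    and [measurable]: "\<phi> \<in> borel_measurable (lborel_CN N)"
    and nonneg: "\<And>z. 0 \<le> \<phi> z"
    and inv: "\<And>w z. cmod w = 1 \<Longrightarrow> \<phi> (\<lambda>i\<in>{..<N}. w * z i) = \<phi> z"
  shows "(\<integral>\<^sup>+z. ennreal ((cmod (\<Sum>d<n. k d z))\<^sup>2 * \<phi> z) \<partial>lborel_CN N)
    \<le> (\<integral>\<^sup>+z. ennreal ((cmod (G z))\<^sup>2 * \<phi> z) \<partial>lborel_CN N)"
proof -
  have k_meas [measurable]: "k d \<in> borel_measurable (lborel_CN N)" for d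
    using k polys_borel_measurable unfolding homogeneous_expansion_def by blast
  have G_meas [measurable]: "G \<in> borel_measurable (lborel_CN N)"
    using k by (rule homogeneous_expansion_measurable)
  have k_rot: "k d (\<lambda>i\<in>{..<N}. t * z i) = k d z * t ^ d" for d t z
  proof -
    have "k d (\<lambda>i\<in>{..<N}. t * z i) = k d (\<lambda>i. t * z i)"
      using k polys_restrict unfolding homogeneous_expansion_def by blast
    then show ?thesis
      using k by (simp add: homogeneous_expansion_def)
  qed
  have G_rot: "(\<Sum>d. k d z * t ^ d) = G (\<lambda>i\<in>{..<N}. t * z i)" for t z
  proof -
    have "(\<lambda>d. k d (\<lambda>i\<in>{..<N}. t * z i)) sums G (\<lambda>i\<in>{..<N}. t * z i)"
      using k unfolding homogeneous_expansion_def by blast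
    then show ?thesis
      unfolding k_rot by (rule sums_unique[symmetric])
  qed
  define A where "A q z = (\<Sum>j<q. (cmod (G (\<lambda>i\<in>{..<N}. cis (2 * pi / real q) ^ j * z i)))\<^sup>2) / real q * \<phi> z" for q z
  have A_meas [measurable]: "(\<lambda>z. ennreal (A q z)) \<in> borel_measurable (lborel_CN N)" for q
    unfolding A_def by measurable
  \<comment> \<open>The number \<open>Suc n\<close> of sampling points is positive and at least
    \<open>n\<close>, so Parseval is exact for the partial sum.\<close>
  have "(\<integral>\<^sup>+z. ennreal ((cmod (\<Sum>d<n. k d z))\<^sup>2 * \<phi> z) \<partial>lborel_CN N)
      = (\<integral>\<^sup>+z. ennreal ((\<Sum>j<Suc n. (cmod (\<Sum>d<n. k d (\<lambda>i\<in>{..<N}. cis (2 * pi / real (Suc n)) ^ j * z i)))\<^sup>2) / real (Suc n) * \<phi> z) \<partial>lborel_CN N)"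
    by (rule nn_integral_rotation_average[symmetric]) (simp_all add: nonneg inv)
  also have "\<dots> = (\<integral>\<^sup>+z. ennreal ((\<Sum>d<n. (cmod (k d z))\<^sup>2) * \<phi> z) \<partial>lborel_CN N)"
    unfolding k_rot by (subst parseval_roots_unity) (simp_all del: of_nat_Suc)
  also have "\<dots> \<le> (\<integral>\<^sup>+z. liminf (\<lambda>q. ennreal (A q z)) \<partial>lborel_CN N)"
  proof (rule nn_integral_mono)
    fix z
    \<comment> \<open>The root of the weight is absorbed into the coefficients, which puts
      \<open>\<phi> z\<close> inside the limit inferior.\<close>
    define s where "s = complex_of_real (sqrt (\<phi> z))"
    have s: "(cmod s)\<^sup>2 = \<phi> z"
      using nonneg[of z] by (simp add: s_def)
    have summ: "summable (\<lambda>d. cmod (k d z * t ^ d))" for t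
      using homogeneous_expansion_summable[OF k, of "\<lambda>i\<in>{..<N}. t * z i"] unfolding k_rot .
    have "summable (\<lambda>d. cmod (k d z * s))"
      using summable_mult2[OF homogeneous_expansion_summable[OF k, of z], of "cmod s"] by (simp add: norm_mult)
    from bessel_roots_unity[OF this, of n]
    have "ennreal ((\<Sum>d<n. (cmod (k d z))\<^sup>2) * \<phi> z) \<le>
        liminf (\<lambda>q. ennreal ((\<Sum>j<q. (cmod (\<Sum>d. k d z * s * (cis (2 * pi / real q) ^ j) ^ d))\<^sup>2) / real q))"
      by (simp add: norm_mult power_mult_distrib s sum_distrib_right)
    moreover have "(\<Sum>d. k d z * s * t ^ d) = G (\<lambda>i\<in>{..<N}. t * z i) * s" for t
      using suminf_mult2[OF summable_norm_cancel[OF summ[of t]], of s] unfolding G_rot by (simp add: mult_ac)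
    ultimately show "ennreal ((\<Sum>d<n. (cmod (k d z))\<^sup>2) * \<phi> z) \<le> liminf (\<lambda>q. ennreal (A q z))"
      by (simp add: A_def norm_mult power_mult_distrib s sum_distrib_right[symmetric])
  qed
  \<comment> \<open>Fatou's lemma; for \<open>q \<ge> 1\<close> every averaged integral equals the
    one for \<open>G\<close>.\<close>
  also have "\<dots> \<le> liminf (\<lambda>q. \<integral>\<^sup>+z. ennreal (A q z) \<partial>lborel_CN N)"
    by (rule nn_integral_liminf) simp
  also have "\<dots> \<le> liminf (\<lambda>q::nat. \<integral>\<^sup>+z. ennreal ((cmod (G z))\<^sup>2 * \<phi> z) \<partial>lborel_CN N)"
  proof (rule Liminf_mono, rule eventually_sequentiallyI)
    fix q :: nat assume "1 \<le> q"
    then have "(\<integral>\<^sup>+z. ennreal (A q z) \<partial>lborel_CN N) = (\<integral>\<^sup>+z. ennreal ((cmod (G z))\<^sup>2 * \<phi> z) \<partial>lborel_CN N)"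
      unfolding A_def by (intro nn_integral_rotation_average) (simp_all add: nonneg inv)
    then show "(\<integral>\<^sup>+z. ennreal (A q z) \<partial>lborel_CN N) \<le> (\<integral>\<^sup>+z. ennreal ((cmod (G z))\<^sup>2 * \<phi> z) \<partial>lborel_CN N)"
      by simp
  qed
  also have "\<dots> = (\<integral>\<^sup>+z. ennreal ((cmod (G z))\<^sup>2 * \<phi> z) \<partial>lborel_CN N)"
    by (rule Liminf_const) simp
  finally show ?thesis .
qed

text \<open>Only \<open>G\<close> is truncated, while the Vandermonde factor stays in the rotation
  invariant weight \<open>\<phi>\<close>. Each truncation thus keeps the vanishing orders and obeys
  the polynomial bound; its norm is at most that of \<open>G\<close>, and Fatou's lemma gives the
  limit on the left.\<close>

lemma entire_gaussian_bound:
  fixes t :: real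
  assumes k: "homogeneous_expansion N k G" and t: "0 < t" and l: "1 \<le> l"
  defines "f \<equiv> \<lambda>z. (cmod (G z * vandermonde_power l N z))\<^sup>2 * exp (- (\<Sum>i<N. (cmod (z i))\<^sup>2))"
  shows "(\<integral>\<^sup>+z. ennreal (f z * (\<Sum>i<N. exp (- t * (cmod (z i))\<^sup>2))) \<partial>lborel_CN N)
    \<le> ennreal ((1 + real l * t) / (real l * t)) * (\<integral>\<^sup>+z. ennreal (f z) \<partial>lborel_CN N)"
proof -
  define \<phi> where "\<phi> z = (cmod (vandermonde_power l N z))\<^sup>2 * exp (- (\<Sum>i<N. (cmod (z i))\<^sup>2))" for z
  define W where "W z = (\<Sum>i<N. exp (- t * (cmod (z i))\<^sup>2))" for z :: "nat \<Rightarrow> complex"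
  define S where "S n z = (\<Sum>d<n. k d z)" for n z
  define K where "K = ennreal ((1 + real l * t) / (real l * t))"
  have [measurable]: "vandermonde_power l N \<in> borel_measurable (lborel_CN N)"
    by (rule polys_borel_measurable[OF vandermonde_power_polys])
  have [measurable]: "\<phi> \<in> borel_measurable (lborel_CN N)" "W \<in> borel_measurable (lborel_CN N)"
    unfolding \<phi>_def W_def by measurable
  have S_polys: "S n \<in> polys N (\<lambda>_. 0)" for n
    unfolding S_def using k by (intro polys_sum) (simp add: homogeneous_expansion_def)
  have [measurable]: "S n \<in> borel_measurable (lborel_CN N)" for n
    by (rule polys_borel_measurable[OF S_polys])
  have \<phi>0: "0 \<le> \<phi> z" for z
    by (simp add: \<phi>_def)
  have \<phi>_rot: "\<phi> (\<lambda>i\<in>{..<N}. w * z i) = \<phi> z" if "cmod w = 1" for w z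
    using that cmod_vandermonde_power_rotate[OF that, of l N z]
    by (simp add: \<phi>_def polys_restrict[OF vandermonde_power_polys] norm_mult)
  have SV: "(\<integral>\<^sup>+z. ennreal ((cmod (S n z))\<^sup>2 * \<phi> z * W z) \<partial>lborel_CN N)
      \<le> K * (\<integral>\<^sup>+z. ennreal ((cmod (G z))\<^sup>2 * \<phi> z) \<partial>lborel_CN N)" for n
  proof -
    have "(\<lambda>z. S n z * vandermonde_power l N z) \<in> polys N (\<lambda>S. l * (card S choose 2))"
      using polys_mult[OF S_polys vandermonde_power_polys] by simp
    from polys_gaussian_bound[OF this t l]
    have "(\<integral>\<^sup>+z. ennreal ((cmod (S n z))\<^sup>2 * \<phi> z * W z) \<partial>lborel_CN N)
        \<le> K * (\<integral>\<^sup>+z. ennreal ((cmod (S n z))\<^sup>2 * \<phi> z) \<partial>lborel_CN N)"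
      unfolding \<phi>_def W_def K_def by (simp only: norm_mult power_mult_distrib mult.assoc)
    also have "\<dots> \<le> K * (\<integral>\<^sup>+z. ennreal ((cmod (G z))\<^sup>2 * \<phi> z) \<partial>lborel_CN N)"
      unfolding S_def by (intro mult_left_mono nn_integral_partial_sum_le[OF k] \<phi>0 \<phi>_rot) auto
    finally show ?thesis .
  qed
  have "(\<integral>\<^sup>+z. ennreal ((cmod (G z))\<^sup>2 * \<phi> z * W z) \<partial>lborel_CN N)
      = (\<integral>\<^sup>+z. liminf (\<lambda>n. ennreal ((cmod (S n z))\<^sup>2 * \<phi> z * W z)) \<partial>lborel_CN N)"
  proof (rule nn_integral_cong)
    fix z
    have "(\<lambda>n. S n z) \<longlonglongrightarrow> G z"
      using k unfolding S_def homogeneous_expansion_def sums_def by blast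
    then have "(\<lambda>n. ennreal ((cmod (S n z))\<^sup>2 * \<phi> z * W z)) \<longlonglongrightarrow> ennreal ((cmod (G z))\<^sup>2 * \<phi> z * W z)"
      by (intro tendsto_ennrealI tendsto_intros)
    then show "ennreal ((cmod (G z))\<^sup>2 * \<phi> z * W z) = liminf (\<lambda>n. ennreal ((cmod (S n z))\<^sup>2 * \<phi> z * W z))"
      by (rule lim_imp_Liminf[OF sequentially_bot, symmetric])
  qed
  also have "\<dots> \<le> liminf (\<lambda>n. \<integral>\<^sup>+z. ennreal ((cmod (S n z))\<^sup>2 * \<phi> z * W z) \<partial>lborel_CN N)"
    by (rule nn_integral_liminf) simp
  also have "\<dots> \<le> liminf (\<lambda>n::nat. K * (\<integral>\<^sup>+z. ennreal ((cmod (G z))\<^sup>2 * \<phi> z) \<partial>lborel_CN N))"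
    using SV by (intro Liminf_mono always_eventually allI)
  also have "\<dots> = K * (\<integral>\<^sup>+z. ennreal ((cmod (G z))\<^sup>2 * \<phi> z) \<partial>lborel_CN N)"
    by (rule Liminf_const) simp
  finally show ?thesis
    unfolding f_def \<phi>_def W_def K_def by (simp only: norm_mult power_mult_distrib mult.assoc)
qed

section \<open>The one-particle density\<close>

text \<open>Every unordered pair occurs twice in the full product.\<close>

lemma prod_offdiagonal_eq_prod_pairs_squared:
  fixes g :: "nat \<Rightarrow> nat \<Rightarrow> real"
  assumes sym: "\<And>i j. g i j = g j i"
  shows "(\<Prod>j<N. \<Prod>i<N. if i = j then 1 else g i j) = (\<Prod>j<N. \<Prod>i<j. g i j)\<^sup>2"
proof (induction N)
  case (Suc N)
  have "(\<Prod>i<N. if i = N then 1 else g i N) = (\<Prod>i<N. g i N)"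
    by (intro prod.cong) auto
  moreover have "(\<Prod>j<N. if N = j then 1 else g N j) = (\<Prod>j<N. g j N)"
    using sym by (intro prod.cong) auto
  ultimately show ?case
    using Suc by (simp add: prod.distrib power2_eq_square mult_ac)
qed simp

text \<open>The range \<open>i < j\<close> is not stable under a permutation, but the square is a
  product over all ordered pairs of distinct indices and can be reindexed.\<close>

lemma cmod_vandermonde_power_permute:
  assumes s: "s permutes {..<N}"
  shows "cmod (vandermonde_power l N (z \<circ> s)) = cmod (vandermonde_power l N z)"
proof -
  define g where "g i j = cmod (z i - z j) ^ l" for i j
  have sym: "g i j = g j i" for i j
    by (simp add: g_def norm_minus_commute)
  have inj: "s i = s j \<longleftrightarrow> i = j" for i j
    using permutes_inj[OF s] by (auto dest: injD)
  have bij: "bij_betw s {..<N} {..<N}"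
    using s by (rule permutes_imp_bij)
  have "(cmod (vandermonde_power l N (z \<circ> s)))\<^sup>2 = (\<Prod>j<N. \<Prod>i<N. if i = j then 1 else g (s i) (s j))"
    using sym by (subst prod_offdiagonal_eq_prod_pairs_squared)
      (simp_all add: vandermonde_power_def g_def prod_norm[symmetric] norm_power)
  also have "\<dots> = (\<Prod>j<N. \<Prod>i<N. if s i = s j then 1 else g (s i) (s j))"
    by (simp add: inj)
  also have "\<dots> = (\<Prod>j<N. \<Prod>i<N. if i = s j then 1 else g i (s j))"
    by (intro prod.cong refl prod.reindex_bij_betw[OF bij])
  also have "\<dots> = (\<Prod>j<N. \<Prod>i<N. if i = j then 1 else g i j)"
    by (rule prod.reindex_bij_betw[OF bij])
  also have "\<dots> = (cmod (vandermonde_power l N z))\<^sup>2"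
    using sym by (subst prod_offdiagonal_eq_prod_pairs_squared)
      (simp_all add: vandermonde_power_def g_def prod_norm[symmetric] norm_power)
  finally show ?thesis
    by simp
qed

lemma cmod_correlated_state_squared:
  "(cmod (correlated_state l N F z))\<^sup>2 =
    (c_Lau l N)\<^sup>2 * ((cmod (F z * vandermonde_power l N z))\<^sup>2 * exp (- (\<Sum>i<N. (cmod (z i))\<^sup>2)))"
proof -
  have "(exp (- (\<Sum>i<N. (cmod (z i))\<^sup>2) / 2))\<^sup>2 = exp (- (\<Sum>i<N. (cmod (z i))\<^sup>2))"
    by (simp add: power2_eq_square exp_add[symmetric])
  moreover have "laughlin_unnormalized l N z
      = vandermonde_power l N z * of_real (exp (- (\<Sum>i<N. (cmod (z i))\<^sup>2) / 2))"
    by (simp only: laughlin_unnormalized_def vandermonde_power_def)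
  ultimately show ?thesis
    unfolding correlated_state_def laughlin_def
    by (simp only: norm_mult power_mult_distrib norm_of_real abs_exp_cancel power2_abs mult_ac)
qed

text \<open>The Vandermonde factor depends on differences only, and the cross terms
  \<open>2 * Re (cnj a * z i)\<close> of the squared moduli become the modulus of an entire function
  of \<open>z\<close>.\<close>

lemma cmod_correlated_state_translate:
  "(cmod (correlated_state l N F (\<lambda>i\<in>{..<N}. a + z i)))\<^sup>2 =
    ((c_Lau l N)\<^sup>2 * exp (- (real N * (cmod a)\<^sup>2))) *
    ((cmod (F (\<lambda>i\<in>{..<N}. a + z i) * exp (- cnj a * (\<Sum>i<N. z i)) * vandermonde_power l N z))\<^sup>2
      * exp (- (\<Sum>i<N. (cmod (z i))\<^sup>2)))"
proof -
  have V: "vandermonde_power l N (\<lambda>i\<in>{..<N}. a + z i) = vandermonde_power l N z"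
    by (simp add: vandermonde_power_def)
  have "(cmod (exp (- cnj a * (\<Sum>i<N. z i))))\<^sup>2 = exp (- (\<Sum>i<N. 2 * Re (cnj a * z i)))"
    by (simp add: power2_eq_square exp_add[symmetric] sum_distrib_left sum_negf[symmetric] sum.distrib[symmetric])
  moreover have "(cmod (a + z i))\<^sup>2 = (cmod a)\<^sup>2 + 2 * Re (cnj a * z i) + (cmod (z i))\<^sup>2" for i
    unfolding cmod_power2 by (simp add: power2_eq_square algebra_simps)
  then have "(\<Sum>i<N. (cmod ((\<lambda>i\<in>{..<N}. a + z i) i))\<^sup>2) =
      real N * (cmod a)\<^sup>2 + (\<Sum>i<N. 2 * Re (cnj a * z i)) + (\<Sum>i<N. (cmod (z i))\<^sup>2)"
    by (simp add: sum.distrib)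
  ultimately show ?thesis
    unfolding cmod_correlated_state_squared V
    by (simp only: norm_mult power_mult_distrib minus_add_distrib exp_add mult_ac)
qed

lemma correlated_state_measurable:
  assumes "analytic_CN N F"
  shows "(\<lambda>z. (cmod (correlated_state l N F z))\<^sup>2) \<in> borel_measurable (lborel_CN N)"
proof -
  obtain k where "homogeneous_expansion N k (\<lambda>z. F (\<lambda>i\<in>{..<N}. 0 + z i))"
    using analytic_CN_homogeneous_expansion[OF assms, of "\<lambda>_. 0"] .
  then have "(\<lambda>z. F (\<lambda>i\<in>{..<N}. 0 + z i)) \<in> borel_measurable (lborel_CN N)"
    by (rule homogeneous_expansion_measurable)
  moreover have "(\<lambda>i\<in>{..<N}. 0 + z i) = z" if "z \<in> space (lborel_CN N)" for z
    using that by (auto simp: space_PiM PiE_iff extensional_def fun_eq_iff)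
  ultimately have [measurable]: "F \<in> borel_measurable (lborel_CN N)"
    by (simp cong: measurable_cong)
  have [measurable]: "vandermonde_power l N \<in> borel_measurable (lborel_CN N)"
    by (rule polys_borel_measurable[OF vandermonde_power_polys])
  show ?thesis
    unfolding cmod_correlated_state_squared by measurable
qed

text \<open>A translation by \<open>a\<close> turns \<open>F\<close> into \<open>F (a + z) * exp (- cnj a * \<Sum>i. z i)\<close>, up to a
  constant, so the centre of the Gaussian may be taken to be the origin.\<close>

lemma correlated_state_gaussian_bound:
  fixes t :: real
  assumes F: "fully_correlated l N F" and t: "0 < t" and l: "1 \<le> l"
  shows "(\<integral>\<^sup>+z. ennreal ((cmod (correlated_state l N F z))\<^sup>2 * (\<Sum>i<N. exp (- t * (cmod (z i - a))\<^sup>2))) \<partial>lborel_CN N)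
    \<le> ennreal ((1 + real l * t) / (real l * t))"
proof -
  define \<psi> where "\<psi> z = (cmod (correlated_state l N F z))\<^sup>2" for z
  have an: "analytic_CN N F" and norm1: "(\<integral>\<^sup>+z. ennreal (\<psi> z) \<partial>lborel_CN N) = 1"
    using F by (auto simp: fully_correlated_def \<psi>_def)
  have [measurable]: "\<psi> \<in> borel_measurable (lborel_CN N)"
    unfolding \<psi>_def using an by (rule correlated_state_measurable)
  define G where "G z = F (\<lambda>i\<in>{..<N}. a + z i) * exp (- cnj a * (\<Sum>i<N. z i))" for z
  obtain k where "homogeneous_expansion N k (\<lambda>z. F (\<lambda>i\<in>{..<N}. a + z i))"
    using analytic_CN_homogeneous_expansion[OF an] .
  from homogeneous_expansion_mult[OF this homogeneous_expansion_linear_exp]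
  obtain k' where k': "homogeneous_expansion N k' G"
    unfolding G_def by blast
  have [measurable]: "G \<in> borel_measurable (lborel_CN N)"
    using k' by (rule homogeneous_expansion_measurable)
  have [measurable]: "vandermonde_power l N \<in> borel_measurable (lborel_CN N)"
    by (rule polys_borel_measurable[OF vandermonde_power_polys])
  define f where "f z = (cmod (G z * vandermonde_power l N z))\<^sup>2 * exp (- (\<Sum>i<N. (cmod (z i))\<^sup>2))" for z
  define W where "W z = (\<Sum>i<N. exp (- t * (cmod (z i))\<^sup>2))" for z :: "nat \<Rightarrow> complex"
  define C where "C = (c_Lau l N)\<^sup>2 * exp (- (real N * (cmod a)\<^sup>2))"
  define K where "K = (1 + real l * t) / (real l * t)"
  have [measurable]: "f \<in> borel_measurable (lborel_CN N)" "W \<in> borel_measurable (lborel_CN N)"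
    unfolding f_def W_def by measurable
  have C: "0 \<le> C" and f0: "0 \<le> f z" and W0: "0 \<le> W z" for z
    by (auto simp: C_def f_def W_def intro: sum_nonneg)
  have shift: "(\<integral>\<^sup>+z. h (\<lambda>i\<in>{..<N}. a + z i) \<partial>lborel_CN N) = (\<integral>\<^sup>+z. h z \<partial>lborel_CN N)"
    if "h \<in> borel_measurable (lborel_CN N)" for h :: "(nat \<Rightarrow> complex) \<Rightarrow> ennreal"
    using that
    by (intro nn_integral_PiM_componentwise) (auto simp: distr_lborel_translate lborel.sigma_finite_measure_axioms)
  have \<psi>_shift: "\<psi> (\<lambda>i\<in>{..<N}. a + z i) = C * f z" for z
    unfolding \<psi>_def C_def f_def G_def by (rule cmod_correlated_state_translate)
  have "(\<integral>\<^sup>+z. ennreal (\<psi> z * (\<Sum>i<N. exp (- t * (cmod (z i - a))\<^sup>2))) \<partial>lborel_CN N)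
      = (\<integral>\<^sup>+z. ennreal (C * f z * W z) \<partial>lborel_CN N)"
    by (subst shift[symmetric]) (simp_all add: \<psi>_shift W_def)
  also have "\<dots> = ennreal C * (\<integral>\<^sup>+z. ennreal (f z * W z) \<partial>lborel_CN N)"
    using C f0 W0 by (simp add: nn_integral_cmult[symmetric] ennreal_mult[symmetric] mult.assoc)
  also have "\<dots> \<le> ennreal C * (ennreal K * (\<integral>\<^sup>+z. ennreal (f z) \<partial>lborel_CN N))"
    unfolding f_def W_def K_def by (intro mult_left_mono entire_gaussian_bound[OF k' t l]) simp
  also have "\<dots> = ennreal K * (\<integral>\<^sup>+z. ennreal (C * f z) \<partial>lborel_CN N)"
    using C f0 by (simp add: nn_integral_cmult ennreal_mult mult_ac)
  also have "(\<integral>\<^sup>+z. ennreal (C * f z) \<partial>lborel_CN N) = 1"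
    using shift[of "\<lambda>z. ennreal (\<psi> z)"] norm1 by (simp add: \<psi>_shift)
  finally show ?thesis
    by (simp add: \<psi>_def K_def)
qed

lemma cmod_correlated_state_permute:
  assumes F: "symmetric_CN N F" and s: "s permutes {..<N}" and z: "z \<in> CN N"
  shows "cmod (correlated_state l N F (z \<circ> s)) = cmod (correlated_state l N F z)"
proof -
  have "F (z \<circ> s) = F z"
    using F s z by (simp add: symmetric_CN_def)
  moreover have "(\<Sum>i<N. (cmod ((z \<circ> s) i))\<^sup>2) = (\<Sum>i<N. (cmod (z i))\<^sup>2)"
    using sum.permute[OF s, of "\<lambda>i. (cmod (z i))\<^sup>2"] by (simp add: o_def)
  ultimately have "(cmod (correlated_state l N F (z \<circ> s)))\<^sup>2 = (cmod (correlated_state l N F z))\<^sup>2"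
    unfolding cmod_correlated_state_squared norm_mult cmod_vandermonde_power_permute[OF s] by simp
  then show ?thesis by simp
qed

lemma one_particle_density_measurable:
  assumes "analytic_CN N F" "1 \<le> N"
  shows "one_particle_density l N F \<in> borel_measurable borel"
proof -
  interpret P: sigma_finite_measure "PiM {1..<N} (\<lambda>_. lborel :: complex measure)"
    by (rule lborel_product.sigma_finite) simp
  have N: "insert 0 {1..<N} = {..<N}"
    using assms(2) by auto
  note correlated_state_measurable[OF assms(1), of l, measurable]
  have "(\<lambda>(x, z). z(0 := x)) \<in> lborel \<Otimes>\<^sub>M PiM {1..<N} (\<lambda>_. lborel :: complex measure) \<rightarrow>\<^sub>M PiM (insert 0 {1..<N}) (\<lambda>_. lborel)"
    unfolding case_prod_beta by (rule measurable_fun_upd[where J = "{1..<N}"]) auto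
  then have [measurable]: "(\<lambda>(x, z). z(0 := x)) \<in> lborel \<Otimes>\<^sub>M PiM {1..<N} (\<lambda>_. lborel :: complex measure) \<rightarrow>\<^sub>M lborel_CN N"
    unfolding N .
  have "(\<lambda>x. \<integral>\<^sup>+z. ennreal ((cmod (correlated_state l N F (z(0 := x))))\<^sup>2) \<partial>PiM {1..<N} (\<lambda>_. lborel)) \<in> borel_measurable lborel"
    by measurable
  then show ?thesis
    unfolding one_particle_density_def[abs_def] by simp
qed

text \<open>By symmetry every particle contributes as much as particle \<open>0\<close>, which
  accounts for the factor \<open>N\<close> in the density.\<close>

lemma nn_integral_one_particle_density:
  assumes F: "fully_correlated l N F" and N: "1 \<le> N"
    and b [measurable]: "b \<in> borel_measurable borel" and b0: "\<And>x. 0 \<le> b x"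
  shows "(\<integral>\<^sup>+x. one_particle_density l N F x * ennreal (b x) \<partial>lborel)
    = (\<integral>\<^sup>+z. ennreal ((cmod (correlated_state l N F z))\<^sup>2 * (\<Sum>i<N. b (z i))) \<partial>lborel_CN N)"
proof -
  define \<psi> where "\<psi> z = (cmod (correlated_state l N F z))\<^sup>2" for z
  have an: "analytic_CN N F" and sym: "symmetric_CN N F"
    using F by (auto simp: fully_correlated_def)
  have \<psi>_meas [measurable]: "\<psi> \<in> borel_measurable (lborel_CN N)"
    unfolding \<psi>_def using an by (rule correlated_state_measurable)
  have ins: "insert 0 {1..<N} = {..<N}"
    using N by auto
  have one: "(\<integral>\<^sup>+z. ennreal (\<psi> z * b (z i)) \<partial>lborel_CN N) = (\<integral>\<^sup>+z. ennreal (\<psi> z * b (z 0)) \<partial>lborel_CN N)"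
    if i: "i < N" for i
  proof -
    \<comment> \<open>This exchanges particle \<open>i\<close> with the particle that the density
      singles out.\<close>
    define s where "s = Transposition.transpose 0 i"
    have s: "s permutes {..<N}"
      unfolding s_def using i N by (intro permutes_swap_id) auto
    have "(\<integral>\<^sup>+z. ennreal (\<psi> z * b (z 0)) \<partial>lborel_CN N) = (\<integral>\<^sup>+z. ennreal (\<psi> (z \<circ> s) * b ((z \<circ> s) 0)) \<partial>lborel_CN N)"
      using N by (intro nn_integral_PiM_permute[symmetric] s lborel.sigma_finite_measure_axioms) auto
    also have "\<dots> = (\<integral>\<^sup>+z. ennreal (\<psi> z * b (z i)) \<partial>lborel_CN N)"
      by (intro nn_integral_cong)
         (simp add: \<psi>_def space_PiM cmod_correlated_state_permute[OF sym s] s_def[symmetric],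
          simp add: s_def)
    finally show ?thesis by simp
  qed
  have upd: "(\<lambda>z. z(0 := x)) \<in> PiM {1..<N} (\<lambda>_. lborel :: complex measure) \<rightarrow>\<^sub>M lborel_CN N" for x
    unfolding ins[symmetric] by (rule measurable_fun_upd[where J = "{1..<N}"]) auto
  have "(\<integral>\<^sup>+x. one_particle_density l N F x * ennreal (b x) \<partial>lborel)
      = (\<integral>\<^sup>+x. of_nat N * (\<integral>\<^sup>+z. ennreal (\<psi> (z(0 := x)) * b ((z(0 := x)) 0)) \<partial>PiM {1..<N} (\<lambda>_. lborel)) \<partial>lborel)"
  proof (rule nn_integral_cong)
    fix x
    have "(\<lambda>z. ennreal (\<psi> (z(0 := x)))) \<in> borel_measurable (PiM {1..<N} (\<lambda>_. lborel))"
      using measurable_compose[OF upd \<psi>_meas] by simp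
    then show "one_particle_density l N F x * ennreal (b x) =
        of_nat N * (\<integral>\<^sup>+z. ennreal (\<psi> (z(0 := x)) * b ((z(0 := x)) 0)) \<partial>PiM {1..<N} (\<lambda>_. lborel))"
      using b0 by (simp add: one_particle_density_def \<psi>_def ennreal_mult nn_integral_multc mult.assoc)
  qed
  also have "\<dots> = of_nat N * (\<integral>\<^sup>+x. (\<integral>\<^sup>+z. ennreal (\<psi> (z(0 := x)) * b ((z(0 := x)) 0)) \<partial>PiM {1..<N} (\<lambda>_. lborel)) \<partial>lborel)"
  proof (rule nn_integral_cmult)
    interpret P: sigma_finite_measure "PiM {1..<N} (\<lambda>_. lborel :: complex measure)"
      by (rule lborel_product.sigma_finite) simp
    have "(\<lambda>(x, z). z(0 := x)) \<in> lborel \<Otimes>\<^sub>M PiM {1..<N} (\<lambda>_. lborel :: complex measure) \<rightarrow>\<^sub>M lborel_CN N"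
      unfolding case_prod_beta ins[symmetric] by (rule measurable_fun_upd[where J = "{1..<N}"]) auto
    then show "(\<lambda>x. \<integral>\<^sup>+z. ennreal (\<psi> (z(0 := x)) * b ((z(0 := x)) 0)) \<partial>PiM {1..<N} (\<lambda>_. lborel)) \<in> borel_measurable lborel"
      by measurable
  qed
  \<comment> \<open>Tonelli: the coordinate \<open>0\<close> is reinserted into the product over the
    other particles.\<close>
  also have "(\<integral>\<^sup>+x. (\<integral>\<^sup>+z. ennreal (\<psi> (z(0 := x)) * b ((z(0 := x)) 0)) \<partial>PiM {1..<N} (\<lambda>_. lborel)) \<partial>lborel)
      = (\<integral>\<^sup>+z. ennreal (\<psi> z * b (z 0)) \<partial>lborel_CN N)"
  proof -
    have "(\<lambda>z. ennreal (\<psi> z * b (z 0))) \<in> borel_measurable (PiM (insert 0 {1..<N}) (\<lambda>_. lborel))"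
    proof -
      have [measurable]: "(\<lambda>z. z 0) \<in> lborel_CN N \<rightarrow>\<^sub>M borel"
        using N measurable_component_singleton[of 0 "{..<N}" "\<lambda>_. lborel :: complex measure"] by simp
      show ?thesis
        unfolding ins by measurable
    qed
    from lborel_product.product_nn_integral_insert_rev[OF _ _ this] show ?thesis
      unfolding ins by simp
  qed
  also have "of_nat N * \<dots> = (\<Sum>i<N. \<integral>\<^sup>+z. ennreal (\<psi> z * b (z i)) \<partial>lborel_CN N)"
  proof -
    have "(\<Sum>i<N. \<integral>\<^sup>+z. ennreal (\<psi> z * b (z i)) \<partial>lborel_CN N)
        = (\<Sum>i<N. \<integral>\<^sup>+z. ennreal (\<psi> z * b (z 0)) \<partial>lborel_CN N)"
      by (intro sum.cong refl one) simp
    then show ?thesis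
      by simp
  qed
  also have "\<dots> = (\<integral>\<^sup>+z. (\<Sum>i<N. ennreal (\<psi> z * b (z i))) \<partial>lborel_CN N)"
    by (rule nn_integral_sum[symmetric]) auto
  also have "\<dots> = (\<integral>\<^sup>+z. ennreal (\<psi> z * (\<Sum>i<N. b (z i))) \<partial>lborel_CN N)"
    using b0 by (simp add: \<psi>_def sum_distrib_left)
  finally show ?thesis
    by (simp add: \<psi>_def)
qed

section \<open>From Gaussians to disks\<close>

lemma nn_integral_gaussian_cball_ge:
  assumes t: "0 < t" and r: "0 \<le> r"
  shows "ennreal (pi / t * (1 - 2 * exp (- t * r\<^sup>2 / 2)))
    \<le> (\<integral>\<^sup>+a. ennreal (exp (- t * (cmod (x - a))\<^sup>2)) * indicator (cball x r) a \<partial>lborel)"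
    (is "_ \<le> ?I")
proof -
  have [measurable]: "cball x r \<in> sets borel"
    by simp
  have shift: "(\<integral>\<^sup>+a. ennreal (exp (- s * (cmod (x - a))\<^sup>2)) \<partial>lborel) = ennreal (pi / s)" if "0 < s" for s
  proof -
    have "(\<integral>\<^sup>+a. ennreal (exp (- s * (cmod a)\<^sup>2)) \<partial>lborel) =
        (\<integral>\<^sup>+a. ennreal (exp (- s * (cmod a)\<^sup>2)) \<partial>distr lborel lborel ((+) (- x)))"
      by (simp only: distr_lborel_translate)
    also have "\<dots> = (\<integral>\<^sup>+a. ennreal (exp (- s * (cmod (x - a))\<^sup>2)) \<partial>lborel)"
      by (subst nn_integral_distr) (simp_all add: norm_minus_commute)
    finally show ?thesis
      using nn_integral_gaussian_complex[OF that] by simp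
  qed
  have "ennreal (pi / t) = (\<integral>\<^sup>+a. ennreal (exp (- t * (cmod (x - a))\<^sup>2)) \<partial>lborel)"
    using shift[OF t] by simp
  \<comment> \<open>Outside the ball half of the exponent is estimated by its value at radius
    \<open>r\<close>. The other half integrates to \<open>2 * pi / t\<close>, the source of the
    factor 2.\<close>
  also have "\<dots> \<le> (\<integral>\<^sup>+a. ennreal (exp (- t * (cmod (x - a))\<^sup>2)) * indicator (cball x r) a
      + ennreal (exp (- t * r\<^sup>2 / 2)) * ennreal (exp (- (t / 2) * (cmod (x - a))\<^sup>2)) \<partial>lborel)"
  proof (rule nn_integral_mono)
    fix a
    show "ennreal (exp (- t * (cmod (x - a))\<^sup>2)) \<le> ennreal (exp (- t * (cmod (x - a))\<^sup>2)) * indicator (cball x r) a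
      + ennreal (exp (- t * r\<^sup>2 / 2)) * ennreal (exp (- (t / 2) * (cmod (x - a))\<^sup>2))"
    proof (cases "a \<in> cball x r")
      case True
      then show ?thesis by simp
    next
      case False
      then have "r\<^sup>2 \<le> (cmod (x - a))\<^sup>2"
        using r by (intro power_mono) (auto simp: dist_norm)
      then have "t * r\<^sup>2 \<le> t * (cmod (x - a))\<^sup>2"
        using t by simp
      then have "exp (- t * (cmod (x - a))\<^sup>2) \<le> exp (- t * r\<^sup>2 / 2) * exp (- (t / 2) * (cmod (x - a))\<^sup>2)"
        unfolding exp_add[symmetric] by simp
      then show ?thesis
        using False by (simp add: ennreal_mult[symmetric] ennreal_leI)
    qed
  qed
  also have "\<dots> = ?I + ennreal (exp (- t * r\<^sup>2 / 2)) * ennreal (pi / (t / 2))"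
  proof (subst nn_integral_add)
    have "(\<integral>\<^sup>+a. ennreal (exp (- (t / 2) * (cmod (x - a))\<^sup>2)) \<partial>lborel) = ennreal (pi / (t / 2))"
      using t by (intro shift) simp
    then show "?I + (\<integral>\<^sup>+a. ennreal (exp (- t * r\<^sup>2 / 2)) * ennreal (exp (- (t / 2) * (cmod (x - a))\<^sup>2)) \<partial>lborel)
        = ?I + ennreal (exp (- t * r\<^sup>2 / 2)) * ennreal (pi / (t / 2))"
      by (subst nn_integral_cmult) simp_all
  qed measurable
  also have "\<dots> = ?I + ennreal (pi / t * (2 * exp (- t * r\<^sup>2 / 2)))"
    using t by (simp add: ennreal_mult[symmetric] mult_ac)
  finally have "ennreal (pi / t) - ennreal (pi / t * (2 * exp (- t * r\<^sup>2 / 2))) \<le> ?I"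
    by (simp add: ennreal_minus_le_iff add.commute)
  then show ?thesis
    using t by (simp add: ennreal_minus right_diff_distrib)
qed

text \<open>Double counting: every point of the disk receives total weight at least
  \<open>\<delta>\<close> from the Gaussians centred in the enlarged disk, while each single
  Gaussian collects at most \<open>K\<close>. The area \<open>pi * (R + r)\<^sup>2\<close> measures
  the set of centres.\<close>

lemma density_disk_bound:
  assumes F: "fully_correlated l N F" and N: "1 \<le> N" and l: "1 \<le> l"
    and t: "0 < t" and r: "0 \<le> r" and R: "0 \<le> R" and pos: "0 < 1 - 2 * exp (- t * r\<^sup>2 / 2)"
  shows "(\<integral>\<^sup>+x\<in>cball c R. one_particle_density l N F x \<partial>lborel)
    \<le> ennreal ((1 + real l * t) / real l * (R + r)\<^sup>2 / (1 - 2 * exp (- t * r\<^sup>2 / 2)))"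
proof -
  define \<rho> where "\<rho> = one_particle_density l N F"
  define K where "K = (1 + real l * t) / (real l * t)"
  define \<delta> where "\<delta> = pi / t * (1 - 2 * exp (- t * r\<^sup>2 / 2))"
  have [measurable]: "\<rho> \<in> borel_measurable borel"
    unfolding \<rho>_def using F N by (intro one_particle_density_measurable) (simp_all add: fully_correlated_def)
  have [measurable]: "cball c s \<in> sets borel" for s
    by simp
  have K: "0 \<le> K" and \<delta>: "0 < \<delta>"
    using t l pos by (auto simp: K_def \<delta>_def intro!: divide_nonneg_nonneg)
  have gauss: "(\<integral>\<^sup>+x. \<rho> x * ennreal (exp (- t * (cmod (x - a))\<^sup>2)) \<partial>lborel) \<le> ennreal K" for a
    unfolding \<rho>_def K_def
    using correlated_state_gaussian_bound[OF F t l] by (subst nn_integral_one_particle_density[OF F N]) auto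
  have "ennreal \<delta> * (\<integral>\<^sup>+x\<in>cball c R. \<rho> x \<partial>lborel) = (\<integral>\<^sup>+x. \<rho> x * (ennreal \<delta> * indicator (cball c R) x) \<partial>lborel)"
    by (subst nn_integral_cmult[symmetric]) (auto simp: mult_ac)
  also have "\<dots> \<le> (\<integral>\<^sup>+x. \<rho> x * (\<integral>\<^sup>+a. ennreal (exp (- t * (cmod (x - a))\<^sup>2)) * indicator (cball c (R + r)) a \<partial>lborel) \<partial>lborel)"
  proof (intro nn_integral_mono mult_left_mono)
    fix x
    show "ennreal \<delta> * indicator (cball c R) x \<le>
        (\<integral>\<^sup>+a. ennreal (exp (- t * (cmod (x - a))\<^sup>2)) * indicator (cball c (R + r)) a \<partial>lborel)"
    proof (cases "x \<in> cball c R")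
      case True
      have "cball x r \<subseteq> cball c (R + r)"
      proof
        fix a assume "a \<in> cball x r"
        then show "a \<in> cball c (R + r)"
          using True dist_triangle[of c a x] by simp
      qed
      then have "ennreal \<delta> \<le> (\<integral>\<^sup>+a. ennreal (exp (- t * (cmod (x - a))\<^sup>2)) * indicator (cball c (R + r)) a \<partial>lborel)"
        unfolding \<delta>_def
        by (intro order_trans[OF nn_integral_gaussian_cball_ge[OF t r, of x]] nn_integral_mono mult_left_mono)
           (auto simp: indicator_def)
      then show ?thesis using True by simp
    qed simp
  qed simp
  also have "\<dots> = (\<integral>\<^sup>+x. \<integral>\<^sup>+a. \<rho> x * ennreal (exp (- t * (cmod (x - a))\<^sup>2)) * indicator (cball c (R + r)) a \<partial>lborel \<partial>lborel)"
    by (subst nn_integral_cmult[symmetric]) (simp_all add: mult.assoc)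
  also have "\<dots> = (\<integral>\<^sup>+a. \<integral>\<^sup>+x. \<rho> x * ennreal (exp (- t * (cmod (x - a))\<^sup>2)) * indicator (cball c (R + r)) a \<partial>lborel \<partial>lborel)"
    by (rule lborel_pair.Fubini'[symmetric]) measurable
  also have "\<dots> = (\<integral>\<^sup>+a. (\<integral>\<^sup>+x. \<rho> x * ennreal (exp (- t * (cmod (x - a))\<^sup>2)) \<partial>lborel) * indicator (cball c (R + r)) a \<partial>lborel)"
    by (subst nn_integral_multc) auto
  also have "\<dots> \<le> (\<integral>\<^sup>+a. ennreal K * indicator (cball c (R + r)) a \<partial>lborel)"
    using gauss by (intro nn_integral_mono mult_right_mono) auto
  also have "\<dots> = ennreal K * ennreal (pi * (R + r)\<^sup>2)"
    using R r by (subst nn_integral_cmult_indicator) (auto simp: emeasure_cball unit_ball_vol_numeral)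
  also have "\<dots> = ennreal (K * (pi * (R + r)\<^sup>2))"
    using K by (simp add: ennreal_mult)
  finally have "ennreal (1 / \<delta>) * (ennreal \<delta> * (\<integral>\<^sup>+x\<in>cball c R. \<rho> x \<partial>lborel))
      \<le> ennreal (1 / \<delta>) * ennreal (K * (pi * (R + r)\<^sup>2))"
    by (rule mult_left_mono) simp
  also have "\<dots> = ennreal ((1 + real l * t) / real l * (R + r)\<^sup>2 / (1 - 2 * exp (- t * r\<^sup>2 / 2)))"
  proof -
    \<comment> \<open>The factors \<open>pi\<close> and \<open>1 / t\<close> of
      \<open>\<delta>\<close> cancel against the area and against \<open>K\<close>.\<close>
    have "1 / \<delta> * (K * (pi * (R + r)\<^sup>2)) = (1 + real l * t) / real l * (R + r)\<^sup>2 / (1 - 2 * exp (- t * r\<^sup>2 / 2))"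
      using t by (simp add: \<delta>_def K_def)
    then show ?thesis
      using \<delta> K by (simp add: ennreal_mult[symmetric])
  qed
  also have "ennreal (1 / \<delta>) * (ennreal \<delta> * (\<integral>\<^sup>+x\<in>cball c R. \<rho> x \<partial>lborel)) = (\<integral>\<^sup>+x\<in>cball c R. \<rho> x \<partial>lborel)"
    using \<delta> by (simp add: mult.assoc[symmetric] ennreal_mult[symmetric])
  finally show ?thesis
    unfolding \<rho>_def .
qed

theorem theorem1:
  fixes l :: nat and \<alpha> :: real
  assumes "l \<ge> 1" and "\<alpha> > 1 / 4"
  shows "\<forall>\<eta>::real. \<eta> > 0 \<longrightarrow> (\<exists>N0::nat. \<forall>N\<ge>N0.
           \<forall>(c::complex) (D::complex set) (F :: (nat \<Rightarrow> complex) \<Rightarrow> complex).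
             D = cball c (real N powr \<alpha>) \<longrightarrow> fully_correlated l N F \<longrightarrow>
             (\<integral>\<^sup>+ z\<in>D. one_particle_density l N F z \<partial>lborel)
               \<le> ennreal (1 / (pi * real l) * measure lborel D * (1 + \<eta>)))"
proof (intro allI impI)
  fix \<eta> :: real
  assume \<eta>: "\<eta> > 0"
  define L where "L = real l"
  have L: "0 < L" using assms(1) by (simp add: L_def)
  \<comment> \<open>The ratio of the disk bound to \<open>R\<^sup>2 / l\<close> for
    \<open>r = sqrt R\<close> and \<open>t = 1 / sqrt R\<close>. With these choices \<open>t\<close>
    and \<open>r / R\<close> tend to zero while \<open>t * r\<^sup>2 = sqrt R\<close> tends to
    infinity, so all three factors tend to 1.\<close>
  define q where "q R = (1 + L * (1 / sqrt R)) * (1 + 1 / sqrt R)\<^sup>2 / (1 - 2 * exp (- sqrt R / 2))" for R :: real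
  have "(q \<longlongrightarrow> 1) at_top"
    unfolding q_def by real_asymp
  then have "eventually (\<lambda>R. q R < 1 + \<eta>) at_top"
    using \<eta> by (intro order_tendstoD) auto
  moreover have "eventually (\<lambda>R::real. 0 < 1 - 2 * exp (- sqrt R / 2)) at_top"
    by real_asymp
  moreover have "eventually (\<lambda>R::real. 0 < R) at_top"
    by (rule eventually_gt_at_top)
  ultimately have "eventually (\<lambda>R. q R < 1 + \<eta> \<and> 0 < 1 - 2 * exp (- sqrt R / 2) \<and> 0 < R) at_top"
    by eventually_elim simp
  moreover have "filterlim (\<lambda>N::nat. real N powr \<alpha>) at_top at_top"
    using assms(2) by real_asymp
  ultimately have "eventually (\<lambda>N::nat. q (real N powr \<alpha>) < 1 + \<eta> \<and>
      0 < 1 - 2 * exp (- sqrt (real N powr \<alpha>) / 2) \<and> 0 < real N powr \<alpha>) at_top"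
    by (rule eventually_compose_filterlim)
  then obtain N0 where N0: "\<And>N. N0 \<le> N \<Longrightarrow> q (real N powr \<alpha>) < 1 + \<eta> \<and>
      0 < 1 - 2 * exp (- sqrt (real N powr \<alpha>) / 2) \<and> 0 < real N powr \<alpha>"
    unfolding eventually_sequentially by blast
  show "\<exists>N0::nat. \<forall>N\<ge>N0.
           \<forall>(c::complex) (D::complex set) (F :: (nat \<Rightarrow> complex) \<Rightarrow> complex).
             D = cball c (real N powr \<alpha>) \<longrightarrow> fully_correlated l N F \<longrightarrow>
             (\<integral>\<^sup>+ z\<in>D. one_particle_density l N F z \<partial>lborel)
               \<le> ennreal (1 / (pi * real l) * measure lborel D * (1 + \<eta>))"
  \<comment> \<open>The maximum with 1 ensures \<open>1 \<le> N\<close>, as the disk bound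
    demands.\<close>
  proof (intro exI[of _ "max N0 1"] allI impI)
    fix N and c :: complex and D :: "complex set" and F :: "(nat \<Rightarrow> complex) \<Rightarrow> complex"
    assume N: "max N0 1 \<le> N" and D: "D = cball c (real N powr \<alpha>)" and F: "fully_correlated l N F"
    define R where "R = real N powr \<alpha>"
    define t where "t = 1 / sqrt R"
    have R: "q R < 1 + \<eta>" "0 < 1 - 2 * exp (- sqrt R / 2)" "0 < R"
      using N0[of N] N by (auto simp: R_def)
    have t: "0 < t" "t * (sqrt R)\<^sup>2 = sqrt R"
      using R(3) by (auto simp: t_def real_div_sqrt)
    have "(\<integral>\<^sup>+ z\<in>D. one_particle_density l N F z \<partial>lborel)
        \<le> ennreal ((1 + real l * t) / real l * (R + sqrt R)\<^sup>2 / (1 - 2 * exp (- t * (sqrt R)\<^sup>2 / 2)))"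
      unfolding D R_def[symmetric] using N R t assms(1)
      by (intro density_disk_bound[OF F]) auto
    also have "\<dots> \<le> ennreal (1 / (pi * real l) * measure lborel D * (1 + \<eta>))"
    proof (rule ennreal_leI)
      have "R + sqrt R = R * (1 + 1 / sqrt R)"
        using R(3) by (simp add: distrib_left real_div_sqrt)
      then have "(1 + real l * t) / real l * (R + sqrt R)\<^sup>2 / (1 - 2 * exp (- t * (sqrt R)\<^sup>2 / 2)) = R\<^sup>2 / L * q R"
        using t by (simp add: q_def t_def[symmetric] L_def power_mult_distrib)
      also have "\<dots> \<le> R\<^sup>2 / L * (1 + \<eta>)"
        using R(1) L by (intro mult_left_mono) auto
      also have "R\<^sup>2 / L = 1 / (pi * real l) * measure lborel D"
        unfolding D R_def[symmetric] using R(3) by (simp add: content_cball unit_ball_vol_numeral L_def)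
      finally show "(1 + real l * t) / real l * (R + sqrt R)\<^sup>2 / (1 - 2 * exp (- t * (sqrt R)\<^sup>2 / 2))
          \<le> 1 / (pi * real l) * measure lborel D * (1 + \<eta>)" .
    qed
    finally show "(\<integral>\<^sup>+ z\<in>D. one_particle_density l N F z \<partial>lborel)
        \<le> ennreal (1 / (pi * real l) * measure lborel D * (1 + \<eta>))" .
  qed
qed

end
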